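(* Let $T$ be a reduced tree on $n \ge 7$ vertices that contains no pendant $P_3$. Suppose that $T$ is not isomorphic to any graph of the family $G_1$. Then $$m_T(1) \le \frac{n-7}{4},$$ and equality holds if and only if $T$ is isomorphic to $G_4$ or $G_5$.
   Context: All graphs are finite, simple, undirected and connected. $L(G)=D(G)-A(G)$ is the Laplacian matrix of $G$, where $D(G)$ is the diagonal matrix of vertex degrees and $A(G)$ is the adjacency matrix; $m_G(\lambda)$ denotes the multiplicity of $\lambda$ as an eigenvalue of $L(G)$ (equal to $0$ if $\lambda$ is not an eigenvalue). $P_k$ is the path on $k$ vertices. A pendant vertex is a vertex of degree $1$; a quasi-pendant vertex is a vertex adjacent to a pendant vertex. $p(G)$ and $q(G)$ are the numbers of pendant and quasi-pendant vertices of $G$. $G$ is reduced if $p(G)=q(G)$. $G$ contains a pendant $P_k$ if $G$ is obtained from some graph $H$ and a path $P_k$ (vertex-disjoint from $H$) by joining a pendant (end) vertex of $P_k$ to an arbitrary vertex of $H$ by an edge. "Attaching a pendant $P_2$ at a vertex $v$" means adding a new disjoint path $P_2$ and an edge joining one of its endpoints to $v$. Graphs (each is considered up to isomorphism): $G_1$: for an integer $l\ge 1$, take the path $v_1v_2\cdots v_{3l+2}$ and, for each $i=1,\dots,l$, add one new pendant vertex adjacent to $v_{3i}$. The number of vertices is $4l+2$. "$T\cong G_1$" means $T$ is isomorphic to such a tree for some $l\ge1$. $G_4$: the tree on $7$ vertices obtained from a single vertex $c$ by attaching three pendant $P_2$'s at $c$. $G_5$: the tree on $11$ vertices obtained from a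 path $a\,w\,b$ on three vertices by attaching two pendant $P_2$'s at $a$ and two pendant $P_2$'s at $b$. *)

theory Defs
  imports "HOL-Analysis.Analysis"
begin

section \<open>Finite simple graphs\<close>

record 'a ugraph =
  verts :: "'a set"
  edges :: "'a set set"

definition simple_graph :: "'a ugraph \<Rightarrow> bool" where
  "simple_graph G \<longleftrightarrow>
     finite (verts G) \<and> verts G \<noteq> {} \<and> (\<forall>e\<in>edges G. e \<subseteq> verts G \<and> card e = 2)"

definition adj :: "'a ugraph \<Rightarrow> 'a \<Rightarrow> 'a \<Rightarrow> bool" where
  "adj G u v \<longleftrightarrow> {u, v} \<in> edges G"

definition connected_graph :: "'a ugraph \<Rightarrow> bool" where
  "connected_graph G \<longleftrightarrow>
     simple_graph G \<and> (\<forall>u\<in>verts G. \<forall>v\<in>verts G. (adj G)\<^sup>*\<^sup>* u v)"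

definition is_cycle :: "'a ugraph \<Rightarrow> 'a list \<Rightarrow> bool" where
  "is_cycle G c \<longleftrightarrow>
     3 \<le> length c \<and> distinct c \<and> successively (adj G) c \<and> adj G (last c) (hd c)"

definition is_tree :: "'a ugraph \<Rightarrow> bool" where
  "is_tree G \<longleftrightarrow> connected_graph G \<and> (\<nexists>c. is_cycle G c)"

definition graph_iso :: "'a ugraph \<Rightarrow> 'b ugraph \<Rightarrow> bool" (infix \<open>\<cong>\<^sub>g\<close> 50) where
  "G \<cong>\<^sub>g H \<longleftrightarrow>
     (\<exists>f. bij_betw f (verts G) (verts H) \<and>
          (\<forall>u\<in>verts G. \<forall>v\<in>verts G. adj G u v \<longleftrightarrow> adj H (f u) (f v)))"

definition vdegree :: "'a ugraph \<Rightarrow> 'a \<Rightarrow> nat" where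
  "vdegree G v = card {u \<in> verts G. adj G v u}"

section \<open>Pendant vertices and pendant paths\<close>

definition pendant :: "'a ugraph \<Rightarrow> 'a set" where
  "pendant G = {v \<in> verts G. vdegree G v = 1}"

definition quasi_pendant :: "'a ugraph \<Rightarrow> 'a set" where
  "quasi_pendant G = {v \<in> verts G. \<exists>u\<in>pendant G. adj G v u}"

definition reduced_graph :: "'a ugraph \<Rightarrow> bool" where
  "reduced_graph G \<longleftrightarrow> card (pendant G) = card (quasi_pendant G)"

definition path_edges :: "'a list \<Rightarrow> 'a set set" where
  "path_edges p = {{p ! i, p ! Suc i} | i. Suc i < length p}"

definition path_graph :: "'a list \<Rightarrow> 'a ugraph" where
  "path_graph p = \<lparr>verts = set p, edges = path_edges p\<rparr>"

text \<open>
  Join the end vertex \<open>hd p\<close> of the path \<open>p\<close> to the vertex \<open>v\<close> of \<open>G\<close>.  This is meant for a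
  nonempty list \<open>p\<close> of distinct vertices, none of them in \<open>G\<close>.
\<close>

definition attach_path :: "'a ugraph \<Rightarrow> 'a \<Rightarrow> 'a list \<Rightarrow> 'a ugraph" where
  "attach_path G v p =
     \<lparr>verts = verts G \<union> set p, edges = edges G \<union> path_edges p \<union> {{v, hd p}}\<rparr>"

text \<open>
  The graph \<open>H\<close> and the path \<open>p\<close> are taken inside \<open>G\<close> itself, so that \<open>G\<close> is equal
  (not merely isomorphic) to the graph obtained by attaching \<open>p\<close>.
\<close>

definition has_pendant_path :: "nat \<Rightarrow> 'a ugraph \<Rightarrow> bool" where
  "has_pendant_path k G \<longleftrightarrow>
     (\<exists>H v p. connected_graph H \<and> v \<in> verts H \<and> length p = k \<and> distinct p \<and>
        set p \<inter> verts H = {} \<and> G = attach_path H v p)"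

section \<open>Laplacian eigenvalues\<close>

text \<open>
  Matrices are indexed by the whole vertex type, so these notions are meant for graphs \<open>G\<close> with
  \<open>verts G = UNIV\<close>.
\<close>

definition adjacency_matrix :: "'v::finite ugraph \<Rightarrow> real^'v^'v" where
  "adjacency_matrix G = (\<chi> u v. if adj G u v then 1 else 0)"

definition degree_matrix :: "'v::finite ugraph \<Rightarrow> real^'v^'v" where
  "degree_matrix G = (\<chi> u v. if u = v then real (vdegree G u) else 0)"

definition laplacian :: "'v::finite ugraph \<Rightarrow> real^'v^'v" where
  "laplacian G = degree_matrix G - adjacency_matrix G"

text \<open>
  The multiplicity of an eigenvalue is the dimension of its eigenspace (the Laplacian is a real
  symmetric matrix, so geometric and algebraic multiplicities agree); it is \<open>0\<close> for a number that
  is not an eigenvalue.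
\<close>

definition lap_mult :: "'v::finite ugraph \<Rightarrow> real \<Rightarrow> nat" where
  "lap_mult G \<mu> = dim {x. laplacian G *v x = \<mu> *\<^sub>R x}"

section \<open>The exceptional trees\<close>

text \<open>
  The path has the vertices \<open>1, \<dots>, 3 * l + 2\<close>, and \<open>3 * l + 2 + i\<close> is the new pendant vertex
  adjacent to \<open>3 * i\<close>.
\<close>

definition G1 :: "nat \<Rightarrow> nat ugraph" where
  "G1 l = \<lparr>verts = {1..4 * l + 2},
           edges = path_edges [1..<3 * l + 3] \<union> {{3 * i, 3 * l + 2 + i} | i. i \<in> {1..l}}\<rparr>"

text \<open>The centre \<open>c\<close> is \<open>0\<close>.\<close>

definition G4 :: "nat ugraph" where
  "G4 = attach_path (attach_path (attach_path (path_graph [0]) 0 [1, 2]) 0 [3, 4]) 0 [5, 6]"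

text \<open>The path \<open>a w b\<close> is \<open>0, 1, 2\<close>.\<close>

definition G5 :: "nat ugraph" where
  "G5 = attach_path (attach_path (attach_path (attach_path
          (path_graph [0, 1, 2]) 0 [3, 4]) 0 [5, 6]) 2 [7, 8]) 2 [9, 10]"

end

theory Submission
  imports Defs
begin

text \<open>
  An eigenvector \<open>x\<close> of the eigenvalue \<open>1\<close> satisfies \<open>(d v - 1) * x v = (\<Sum>w. x w)\<close> at every vertex
  \<open>v\<close> of degree \<open>d v\<close>, the sum being over the neighbours of \<open>v\<close>.  Eliminating a branch \<open>B\<close> rooted
  at \<open>v\<close> from its leaves upwards leaves one linear relation between \<open>x v\<close> and the value \<open>x u\<close> at the
  parent \<open>u\<close>, and some number \<open>k\<close> of free parameters.  By induction on the branch, the excess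
  \<open>card B - 4 * k\<close> is bounded below in terms of this relation, with explicit extremal branches: the
  smallest values come from segments of a graph of the family \<open>G\<^sub>1\<close>, the next ones from \<open>G\<^sub>4\<close>
  and \<open>G\<^sub>5\<close>.  A reduced tree has a quasi-pendant vertex of degree \<open>2\<close>; with the root there, only
  one branch has to be considered, and the absence of a pendant \<open>P\<^sub>3\<close> controls its first vertex.
\<close>

section \<open>Graphs and linear algebra\<close>

text \<open>The map goes out of \<open>H\<close> because the exceptional trees have numbered
  vertices, so a list of tree vertices yields such a map; the isomorphism is its inverse.
  Injectivity turns equal image edges back into equal edges.\<close>

lemma graph_isoI:
  assumes F: "bij_betw F (verts H) (verts G)"
    and E: "edges G = (`) F ` edges H"
    and sub: "\<And>e. e \<in> edges H \<Longrightarrow> e \<subseteq> verts H"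
  shows "G \<cong>\<^sub>g H"
proof -
  have inj: "inj_on F (verts H)" using F by (simp add: bij_betw_def)
  have *: "{F a, F b} \<in> edges G \<longleftrightarrow> {a, b} \<in> edges H" if "a \<in> verts H" "b \<in> verts H" for a b
  proof
    assume "{F a, F b} \<in> edges G"
    then obtain e where e: "e \<in> edges H" "F ` {a, b} = F ` e" unfolding E by auto
    then have "{a, b} = e" using inj_on_image_eq_iff[OF inj _ sub[OF e(1)], of "{a, b}"] that by simp
    then show "{a, b} \<in> edges H" using e by simp
  next
    assume "{a, b} \<in> edges H"
    then show "{F a, F b} \<in> edges G" unfolding E by (metis image_empty image_eqI image_insert)
  qed
  have "adj G u v \<longleftrightarrow> adj H (inv_into (verts H) F u) (inv_into (verts H) F v)"
    if "u \<in> verts G" "v \<in> verts G" for u v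
  proof -
    have "u \<in> F ` verts H" "v \<in> F ` verts H" using that F by (auto simp: bij_betw_def)
    then show ?thesis
      using *[of "inv_into (verts H) F u" "inv_into (verts H) F v"]
      by (simp add: adj_def inv_into_into f_inv_into_f)
  qed
  then show ?thesis unfolding graph_iso_def using bij_betw_inv_into[OF F] by blast
qed

text \<open>The coordinate projection onto \<open>S\<close> is injective on \<open>W\<close>, and
  its image lies in the span of the unit vectors of \<open>S\<close>.\<close>

lemma dim_le_card_zero_set:
  fixes W :: "(real^'v::finite) set" and S :: "'v set"
  assumes W: "subspace W"
    and zero: "\<And>x. x \<in> W \<Longrightarrow> (\<forall>i\<in>S. x $ i = 0) \<Longrightarrow> x = 0"
  shows "dim W \<le> card S"
proof -
  define P :: "real^'v \<Rightarrow> real^'v" where "P x = (\<chi> i. if i \<in> S then x $ i else 0)" for x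
  have lin: "linear P" by (auto intro!: linearI simp: P_def vec_eq_iff)
  have inj: "inj_on P W"
  proof (rule inj_onI)
    fix x y assume xy: "x \<in> W" "y \<in> W" "P x = P y"
    have "(x - y) $ i = 0" if "i \<in> S" for i
      using that arg_cong[OF xy(3), of "\<lambda>z. z $ i"] by (simp add: P_def)
    then have "\<forall>i\<in>S. (x - y) $ i = 0" by blast
    then show "x = y" using zero[OF subspace_diff[OF W xy(1,2)]] by simp
  qed
  have "dim W = dim (P ` W)" using dim_image_eq[OF lin] inj W
    by (metis span_eq_iff)
  also have "\<dots> \<le> card ((\<lambda>i. axis i (1::real)) ` S :: (real^'v) set)"
  proof (rule dim_le_card)
    show "P ` W \<subseteq> span ((\<lambda>i. axis i (1::real)) ` S)"
    proof
      fix y assume "y \<in> P ` W"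
      then obtain x where y: "y = P x" by blast
      have "y = (\<Sum>i\<in>S. x $ i *\<^sub>R axis i 1)"
        unfolding y by (auto simp: P_def vec_eq_iff axis_def if_distrib cong: if_cong)
      also have "\<dots> \<in> span ((\<lambda>i. axis i (1::real)) ` S)"
        by (intro span_sum span_scale span_base) auto
      finally show "y \<in> span ((\<lambda>i. axis i (1::real)) ` S)" .
    qed
  qed simp
  also have "\<dots> \<le> card S" by (rule card_image_le) simp
  finally show ?thesis .
qed

lemma rtranclp_simple_path:
  assumes "R\<^sup>*\<^sup>* a b"
  shows "\<exists>c. c \<noteq> [] \<and> hd c = a \<and> last c = b \<and> distinct c \<and> successively R c"
  using assms
proof (induction rule: rtranclp_induct)
  case base
  show ?case by (rule exI[of _ "[a]"]) simp
next
  case (step y z)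
  then obtain c where c: "c \<noteq> []" "hd c = a" "last c = y" "distinct c" "successively R c" by blast
  show ?case
  \<comment> \<open>If the new vertex already lies on the path, the path is cut off there instead of
    extended.\<close>
  proof (cases "z \<in> set c")
    case True
    then obtain xs ys where "c = xs @ z # ys" by (meson split_list)
    then show ?thesis using c
      by (intro exI[of _ "xs @ [z]"]) (auto simp: successively_append_iff hd_append)
  next
    case False
    then show ?thesis using c step
      by (intro exI[of _ "c @ [z]"]) (auto simp: successively_append_iff)
  qed
qed

section \<open>Branches of a tree\<close>

locale tree =
  fixes T :: "'v::finite ugraph"
  assumes verts_UNIV: "verts T = UNIV" and is_tree: "is_tree T"
begin

definition nbrs :: "'v \<Rightarrow> 'v set" where "nbrs v = {w. adj T v w}"

text \<open>For adjacent \<open>u\<close> and \<open>v\<close> this is the component of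
  \<open>v\<close> in the tree without \<open>u\<close>. Restricting the steps makes it a transitive
  closure, open to rule induction.\<close>

definition branch :: "'v \<Rightarrow> 'v \<Rightarrow> 'v set" where
  "branch u v = {w. (\<lambda>a b. adj T a b \<and> b \<noteq> u)\<^sup>*\<^sup>* v w}"

definition branch_edges :: "'v \<Rightarrow> 'v \<Rightarrow> 'v set set" where
  "branch_edges u v = {e \<in> edges T. e \<subseteq> branch u v}"

lemma nbrs_sym: "u \<in> nbrs v \<longleftrightarrow> v \<in> nbrs u"
  by (simp add: nbrs_def adj_def insert_commute)

lemma edge_card: "e \<in> edges T \<Longrightarrow> card e = 2"
  using is_tree by (auto simp: is_tree_def connected_graph_def simple_graph_def)

lemma nbrs_irrefl: "v \<notin> nbrs v"
  using edge_card[of "{v, v}"] by (auto simp: nbrs_def adj_def)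

lemma edgeE:
  assumes "e \<in> edges T"
  obtains a b where "e = {a, b}" "b \<in> nbrs a" "a \<noteq> b"
  using edge_card[OF assms] assms by (auto simp: card_2_iff nbrs_def adj_def)

lemma edge_iff: "{a, b} \<in> edges T \<longleftrightarrow> b \<in> nbrs a"
  by (simp add: nbrs_def adj_def)

lemma connected: "(adj T)\<^sup>*\<^sup>* u v"
  using is_tree verts_UNIV by (auto simp: is_tree_def connected_graph_def)

lemma branch_self [simp]: "v \<in> branch u v"
  by (simp add: branch_def)

lemma branch_step: "y \<in> branch u v \<Longrightarrow> z \<in> nbrs y \<Longrightarrow> z \<noteq> u \<Longrightarrow> z \<in> branch u v"
  unfolding branch_def nbrs_def by (auto intro: rtranclp.rtrancl_into_rtrancl)

lemma branch_induct [consumes 1, case_names base step]: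
  assumes "x \<in> branch u v" and "P v"
    and "\<And>y z. y \<in> branch u v \<Longrightarrow> P y \<Longrightarrow> z \<in> nbrs y \<Longrightarrow> z \<noteq> u \<Longrightarrow> P z"
  shows "P x"
proof -
  have "(\<lambda>a b. adj T a b \<and> b \<noteq> u)\<^sup>*\<^sup>* v x" using assms(1) by (simp add: branch_def)
  then show ?thesis
  proof (induction rule: rtranclp_induct)
    case (step y z)
    then show ?case using assms(3)[of y z] by (simp add: nbrs_def branch_def)
  qed (rule assms(2))
qed

lemma parent_notin_branch_of_ne: assumes "u \<noteq> v" shows "u \<notin> branch u v"
proof -
  have "x \<noteq> u" if "x \<in> branch u v" for x
    using that by (induction rule: branch_induct) (use assms in auto)
  then show ?thesis by blast
qed

text \<open>A simple path from \<open>w\<close> to \<open>w'\<close> avoiding \<open>v\<close> would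
  close up through \<open>v\<close> to a cycle. Acyclicity enters here only.\<close>

lemma branch_sibling:
  assumes w: "w \<in> nbrs v" "w' \<in> nbrs v" "w \<noteq> w'"
  shows "w' \<notin> branch v w"
proof
  assume "w' \<in> branch v w"
  then have "(\<lambda>a b. adj T a b \<and> b \<noteq> v)\<^sup>*\<^sup>* w w'" by (simp add: branch_def)
  from rtranclp_simple_path[OF this] obtain c where
    c: "c \<noteq> []" "hd c = w" "last c = w'" "distinct c"
       "successively (\<lambda>a b. adj T a b \<and> b \<noteq> v) c" by blast
  have "v \<noteq> w" using w nbrs_irrefl by blast
  have "v \<notin> set c"
    using c(1,2,5) \<open>v \<noteq> w\<close>
  proof (induction c arbitrary: w)
    case (Cons a c)
    then show ?case by (cases c) auto
  qed simp
  moreover have "successively (adj T) c" using c(5) by (rule successively_mono) auto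
  moreover have "length c \<ge> 2" using c w(3) by (cases c; cases "tl c") auto
  ultimately have "is_cycle T (v # c)"
    using c w by (auto simp: is_cycle_def successively_Cons nbrs_def adj_def insert_commute)
  then show False using is_tree by (auto simp: is_tree_def)
qed

text \<open>A walk leaving \<open>v\<close> stays in the branch of one child until it returns to
  \<open>v\<close>. Conversely, a walk in the branch of a child never meets \<open>u\<close>, a
  different neighbour of \<open>v\<close> (\<open>branch_sibling\<close>).\<close>

lemma branch_rec:
  assumes u: "u \<in> nbrs v"
  shows "branch u v = insert v (\<Union>w\<in>nbrs v - {u}. branch v w)"
proof (intro equalityI subsetI)
  fix x assume "x \<in> branch u v"
  then show "x \<in> insert v (\<Union>w\<in>nbrs v - {u}. branch v w)"
  proof (induction rule: branch_induct)
    case (step y z)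
    then show ?case by (cases "z = v"; cases "y = v") (auto intro: branch_step bexI[of _ z])
  qed simp
next
  fix x assume "x \<in> insert v (\<Union>w\<in>nbrs v - {u}. branch v w)"
  then consider "x = v" | w where "w \<in> nbrs v" "w \<noteq> u" "x \<in> branch v w" by auto
  then show "x \<in> branch u v"
  proof cases
    case 2
    from 2(3) show ?thesis
    proof (induction rule: branch_induct)
      case base
      show ?case using branch_step[OF branch_self] 2 by blast
    next
      case (step y z)
      have "z \<in> branch v w" using step branch_step by blast
      then have "z \<noteq> u" using branch_sibling[of w v u] 2 u by blast
      then show ?case using step branch_step by blast
    qed
  qed simp
qed

lemma UNIV_rec: "UNIV = insert v (\<Union>w\<in>nbrs v. branch v w)"
proof -
  have "x \<in> insert v (\<Union>w\<in>nbrs v. branch v w)" for x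
    using connected[of v x]
  proof (induction rule: rtranclp_induct)
    case (step y z)
    then have "z \<in> nbrs y" by (simp add: nbrs_def)
    then show ?case using step by (cases "z = v"; cases "y = v") (auto intro: branch_step bexI[of _ z])
  qed simp
  then show ?thesis by blast
qed

lemma branch_disjoint:
  assumes "w \<in> nbrs v" "w' \<in> nbrs v" "w \<noteq> w'"
  shows "branch v w \<inter> branch v w' = {}"
proof -
  have "w' \<in> branch v w" if "x \<in> branch v w'" "x \<in> branch v w" for x
  proof -
    \<comment> \<open>The walk from \<open>w'\<close> to \<open>x\<close> is traced backwards, hence
      the implication as induction statement: each predecessor is adjacent to a vertex of
      \<open>branch v w\<close> and differs from \<open>v\<close>.\<close>
    have "x \<in> branch v w \<longrightarrow> w' \<in> branch v w" using that(1)
    proof (induction rule: branch_induct)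
      case (step y z)
      have "y \<noteq> v" using step(1) parent_notin_branch_of_ne[of v w'] nbrs_irrefl assms by auto
      then show ?case using step by (auto simp: nbrs_sym intro: branch_step)
    qed simp
    with that show ?thesis by simp
  qed
  with branch_sibling[OF assms] show ?thesis by blast
qed

lemma parent_notin_branch: "w \<in> nbrs v \<Longrightarrow> v \<notin> branch v w"
  using parent_notin_branch_of_ne nbrs_irrefl by metis

section \<open>Edges and cardinalities of branches\<close>

lemma edges_split:
  assumes "e \<in> edges T"
  shows "e \<in> (\<Union>w\<in>nbrs v. insert {v, w} (branch_edges v w))"
proof -
  obtain a b where e: "e = {a, b}" "b \<in> nbrs a" "a \<noteq> b" using edgeE[OF assms] by blast
  consider "a = v" | "b = v" | "a \<noteq> v" "b \<noteq> v" by blast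
  then show ?thesis
  proof cases
    case 1 then show ?thesis using e by auto
  next
    case 2 then show ?thesis using e by (auto simp: nbrs_sym insert_commute)
  next
    case 3
    then obtain w where w: "w \<in> nbrs v" "a \<in> branch v w" using UNIV_rec[of v] by blast
    then have "b \<in> branch v w" using 3 e by (auto intro: branch_step)
    then show ?thesis using w e assms by (auto simp: branch_edges_def)
  qed
qed

lemma edges_rec: "edges T = (\<Union>w\<in>nbrs v. insert {v, w} (branch_edges v w))"
proof
  show "edges T \<subseteq> (\<Union>w\<in>nbrs v. insert {v, w} (branch_edges v w))" by (intro subsetI edges_split)
  show "(\<Union>w\<in>nbrs v. insert {v, w} (branch_edges v w)) \<subseteq> edges T" by (auto simp: branch_edges_def edge_iff)
qed

lemma branch_edges_rec:
  assumes u: "u \<in> nbrs v"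
  shows "branch_edges u v = (\<Union>w\<in>nbrs v - {u}. insert {v, w} (branch_edges v w))"
proof (intro equalityI subsetI)
  fix e assume e: "e \<in> branch_edges u v"
  then obtain w where w: "w \<in> nbrs v" "e = {v, w} \<or> e \<in> branch_edges v w"
    using edges_split[of e v] by (auto simp: branch_edges_def)
  have ne: "u \<noteq> v" using u nbrs_irrefl by auto
  \<comment> \<open>The edge to the parent contains \<open>u\<close>, which is outside
    \<open>branch u v\<close>; an edge on the parent's side would have an end in two disjoint
    branches at \<open>v\<close>.\<close>
  have "w \<noteq> u"
  proof
    assume "w = u"
    with w have "e = {v, u} \<or> e \<in> branch_edges v u" by simp
    then show False
    proof
      assume "e = {v, u}" then show False using e parent_notin_branch_of_ne[OF ne] by (auto simp: branch_edges_def)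
    next
      assume eu: "e \<in> branch_edges v u"
      then obtain a b where ab: "e = {a, b}" using edgeE[of e] unfolding branch_edges_def by blast
      then have a: "a \<in> branch v u" "a \<in> branch u v" using eu e by (auto simp: branch_edges_def)
      have "a \<noteq> v" using a(1) parent_notin_branch[OF u] by auto
      then obtain w' where "w' \<in> nbrs v" "w' \<noteq> u" "a \<in> branch v w'" using a(2) branch_rec[OF u] by auto
      then show False using branch_disjoint[of w' v u] u a by auto
    qed
  qed
  then show "e \<in> (\<Union>w\<in>nbrs v - {u}. insert {v, w} (branch_edges v w))" using w by auto
next
  fix e assume "e \<in> (\<Union>w\<in>nbrs v - {u}. insert {v, w} (branch_edges v w))"
  then obtain w where w: "w \<in> nbrs v" "w \<noteq> u" "e = {v, w} \<or> e \<in> branch_edges v w" by auto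
  have "branch v w \<subseteq> branch u v" "v \<in> branch u v" using w branch_rec[OF u] by auto
  then show "e \<in> branch_edges u v" using w(1,3) branch_self[of w v] by (auto simp: branch_edges_def edge_iff)
qed

lemma card_branch_less:
  assumes "u \<in> nbrs v" "w \<in> nbrs v - {u}"
  shows "card (branch v w) < card (branch u v)"
proof (rule psubset_card_mono)
  show "branch v w \<subset> branch u v" using branch_rec[OF assms(1)] assms parent_notin_branch[of w v] by blast
qed simp

lemma card_branch_rec:
  assumes "u \<in> nbrs v"
  shows "card (branch u v) = 1 + (\<Sum>w\<in>nbrs v - {u}. card (branch v w))"
proof -
  have "v \<notin> (\<Union>w\<in>nbrs v - {u}. branch v w)" using parent_notin_branch by blast
  moreover have "card (\<Union>w\<in>nbrs v - {u}. branch v w) = (\<Sum>w\<in>nbrs v - {u}. card (branch v w))"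
    by (rule card_UN_disjoint) (simp_all add: branch_disjoint)
  ultimately show ?thesis unfolding branch_rec[OF assms] by simp
qed

end

section \<open>Elimination along branches\<close>

text \<open>
  \<open>r = Some a\<close> stands for the relation \<open>x v = a * x u\<close> between the root \<open>v\<close> of a branch and its
  parent \<open>u\<close>, and \<open>r = None\<close> for the relation \<open>x u = 0\<close>.  If some children of \<open>v\<close> have relation
  \<open>None\<close>, then \<open>x v = 0\<close>, and all but one of their values are new free parameters.  The truncated
  subtraction in \<open>excess\<close> is harmless: it yields \<open>0\<close> if there are no such children.
\<close>

definition slope :: "('v \<Rightarrow> real option) \<Rightarrow> 'v set \<Rightarrow> real option" where
  "slope r C =
     (if \<exists>w\<in>C. r w = None then Some 0
      else if (\<Sum>w\<in>C. the (r w)) = real (card C) then None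
      else Some (1 / (real (card C) - (\<Sum>w\<in>C. the (r w)))))"

definition excess :: "('v \<Rightarrow> real option) \<Rightarrow> ('v \<Rightarrow> int) \<Rightarrow> 'v set \<Rightarrow> int" where
  "excess r h C = 1 + (\<Sum>w\<in>C. h w) - 4 * int (card {w\<in>C. r w = None} - 1)"

context tree
begin

definition lapeq :: "('v \<Rightarrow> real) \<Rightarrow> 'v \<Rightarrow> bool" where
  "lapeq x v \<longleftrightarrow> (real (card (nbrs v)) - 1) * x v = (\<Sum>w\<in>nbrs v. x w)"

text \<open>The integer is the size of the branch minus four times the number of free parameters. As
  a relation it supports rule induction; existence is shown by induction on the size of the
  branch.\<close>

inductive branch_value :: "'v \<Rightarrow> 'v \<Rightarrow> real option \<Rightarrow> int \<Rightarrow> bool" where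
  branch_value: "u \<in> nbrs v \<Longrightarrow> (\<And>w. w \<in> nbrs v - {u} \<Longrightarrow> branch_value v w (r w) (h w)) \<Longrightarrow>
    branch_value u v (slope r (nbrs v - {u})) (excess r h (nbrs v - {u}))"

lemma branch_value_exists: "u \<in> nbrs v \<Longrightarrow> \<exists>r h. branch_value u v r h"
proof (induction "card (branch u v)" arbitrary: u v rule: less_induct)
  case less
  have "\<exists>r h. branch_value v w r h" if "w \<in> nbrs v - {u}" for w
    using less(1)[OF card_branch_less[OF less(2) that]] that nbrs_sym by blast
  then have "\<forall>w. \<exists>rh. w \<in> nbrs v - {u} \<longrightarrow> branch_value v w (fst rh) (snd rh)" by force
  then obtain f where "\<And>w. w \<in> nbrs v - {u} \<Longrightarrow> branch_value v w (fst (f w)) (snd (f w))" by metis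
  then show ?case using branch_value[OF less(2), of "fst \<circ> f" "snd \<circ> f"] by auto
qed

lemma lapeq_branch:
  assumes "u \<in> nbrs v" "lapeq x v"
  shows "real (card (nbrs v - {u})) * x v = x u + (\<Sum>w\<in>nbrs v - {u}. x w)"
proof -
  have "card (nbrs v) = Suc (card (nbrs v - {u}))" using assms(1) by (metis card_Suc_Diff1 finite)
  then show ?thesis using assms by (simp add: lapeq_def sum.remove[of "nbrs v" u])
qed

text \<open>\<open>S\<close> collects the free parameters: once \<open>x u\<close> and
  \<open>x v\<close> vanish, zeros on \<open>S\<close> propagate through the whole branch.\<close>

lemma branch_value_determines:
  assumes "branch_value u v r h"
  shows "\<exists>S. h \<le> int (card (branch u v)) - 4 * int (card S) \<and> S \<subseteq> branch u v \<and>
    (\<forall>x. (\<forall>y\<in>branch u v. lapeq x y) \<longrightarrow>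
       (case r of None \<Rightarrow> x u = 0 | Some a \<Rightarrow> x v = a * x u) \<and>
       (x u = 0 \<and> x v = 0 \<and> (\<forall>y\<in>S. x y = 0) \<longrightarrow> (\<forall>y\<in>branch u v. x y = 0)))"
  using assms
proof (induction rule: branch_value.induct)
  case (branch_value u v r h)
  define C where "C = nbrs v - {u}"
  define J where "J = {w\<in>C. r w = None}"
  let ?P = "\<lambda>w S. h w \<le> int (card (branch v w)) - 4 * int (card S) \<and> S \<subseteq> branch v w \<and>
    (\<forall>x. (\<forall>y\<in>branch v w. lapeq x y) \<longrightarrow>
       (case r w of None \<Rightarrow> x v = 0 | Some a \<Rightarrow> x w = a * x v) \<and>
       (x v = 0 \<and> x w = 0 \<and> (\<forall>y\<in>S. x y = 0) \<longrightarrow> (\<forall>y\<in>branch v w. x y = 0)))"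
  have "\<forall>w\<in>C. \<exists>S. ?P w S" using branch_value.IH unfolding C_def by blast
  then obtain S where S: "\<And>w. w \<in> C \<Longrightarrow> ?P w (S w)" by metis
  have S_sub: "\<And>w. w \<in> C \<Longrightarrow> S w \<subseteq> branch v w" using S by blast
  have CN: "w \<in> nbrs v" if "w \<in> C" for w using that by (simp add: C_def)
  have Brv: "branch u v = insert v (\<Union>w\<in>C. branch v w)"
    using branch_rec[OF branch_value.hyps(1)] by (simp add: C_def)
  have card_branch: "int (card (branch u v)) = 1 + (\<Sum>w\<in>C. int (card (branch v w)))"
    using card_branch_rec[OF branch_value.hyps(1)] by (simp add: C_def)
  have sumh: "(\<Sum>w\<in>C. h w) \<le> (\<Sum>w\<in>C. int (card (branch v w))) - 4 * (\<Sum>w\<in>C. int (card (S w)))"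
  proof -
    have "(\<Sum>w\<in>C. h w) \<le> (\<Sum>w\<in>C. int (card (branch v w)) - 4 * int (card (S w)))"
      using S by (intro sum_mono) blast
    then show ?thesis by (simp add: sum_subtractf sum_distrib_left)
  qed
  have eqv: "real (card C) * x v = x u + (\<Sum>w\<in>C. x w)" if "lapeq x v" for x
    using lapeq_branch[OF branch_value.hyps(1) that] by (simp add: C_def)
  have rel: "case r w of None \<Rightarrow> x v = 0 | Some a \<Rightarrow> x w = a * x v"
    if "\<forall>y\<in>branch u v. lapeq x y" "w \<in> C" for x w
    using S[OF that(2)] that Brv by blast
  have zero: "\<forall>y\<in>branch v w. x y = 0"
    if "\<forall>y\<in>branch u v. lapeq x y" "w \<in> C" "x v = 0" "x w = 0" "\<forall>y\<in>S w. x y = 0" for x w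
    using S[OF that(2)] that Brv by blast
  \<comment> \<open>One child with relation \<open>None\<close> is left out: the equation at
    \<open>v\<close> recovers its value from the others. For empty \<open>J\<close> the set
    \<open>K\<close> is empty, in accordance with the truncated \<open>card J - 1\<close>.\<close>
  define K where "K = J - {SOME w. w \<in> J}"
  have JC: "J \<subseteq> C" by (auto simp: J_def)
  have Kex: "\<exists>w0. J - K \<subseteq> {w0}" by (auto simp: K_def)
  have cardK: "card K = card J - 1"
  proof (cases "J = {}")
    case False
    then have "(SOME w. w \<in> J) \<in> J" by (simp add: some_in_eq)
    then show ?thesis by (simp add: K_def)
  qed (simp add: K_def)
  have finite_zero: "x w = 0" if "\<forall>y\<in>branch u v. lapeq x y" "w \<in> C - J" "x v = 0" for x w
    using rel[OF that(1), of w] that by (auto simp: J_def split: option.splits)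
  have J_zero: "x v = 0" if "\<forall>y\<in>branch u v. lapeq x y" "w \<in> J" for x w
    using rel[OF that(1), of w] that by (auto simp: J_def)
  have finite_eq: "x w = the (r w) * x v" if "\<forall>y\<in>branch u v. lapeq x y" "w \<in> C" "J = {}" for x w
  proof -
    have "r w \<noteq> None" using that by (auto simp: J_def)
    then show ?thesis using rel[OF that(1,2)] by auto
  qed
  define S' where "S' = (\<Union>w\<in>C. S w) \<union> K"
  have "card S' \<le> card (\<Union>w\<in>C. S w) + card K" by (simp add: S'_def card_Un_le)
  also have "\<dots> \<le> (\<Sum>w\<in>C. card (S w)) + (card J - 1)"
    using cardK by (simp add: card_UN_le)
  finally have "int (card S') \<le> (\<Sum>w\<in>C. int (card (S w))) + int (card J - 1)"
    by (metis of_nat_add of_nat_le_iff of_nat_sum)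
  then have bound: "excess r h C \<le> int (card (branch u v)) - 4 * int (card S')"
    using sumh card_branch by (simp add: excess_def J_def)
  have S'_sub: "S' \<subseteq> branch u v"
  proof -
    have "(\<Union>w\<in>C. S w) \<subseteq> branch u v" using S_sub Brv by blast
    moreover have "K \<subseteq> branch u v" using JC Brv branch_self by (auto simp: K_def)
    ultimately show ?thesis by (simp add: S'_def)
  qed
  have relation: "case slope r C of None \<Rightarrow> x u = 0 | Some a \<Rightarrow> x v = a * x u"
    if x: "\<forall>y\<in>branch u v. lapeq x y" for x
  proof (cases "J = {}")
    case False
    then obtain w where w: "w \<in> J" by blast
    then have "slope r C = Some 0" by (auto simp: slope_def J_def)
    then show ?thesis using J_zero[OF x w] by simp
  next
    case True
    have "(\<Sum>w\<in>C. x w) = (\<Sum>w\<in>C. the (r w)) * x v"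
      using finite_eq[OF x _ True] by (simp add: sum_distrib_right)
    \<comment> \<open>The relations of the children are substituted into the equation at
      \<open>v\<close>. A zero coefficient leaves \<open>x u = 0\<close>, the relation
      \<open>None\<close>.\<close>
    then have *: "(real (card C) - (\<Sum>w\<in>C. the (r w))) * x v = x u"
      using eqv[of x] x branch_self[of v u] by (simp add: algebra_simps)
    have "\<not> (\<exists>w\<in>C. r w = None)" using True by (auto simp: J_def)
    then show ?thesis
      using * by (auto simp: slope_def field_simps)
  qed
  have vanish: "\<forall>y\<in>branch u v. x y = 0"
    if x: "\<forall>y\<in>branch u v. lapeq x y" and xu: "x u = 0" and xv: "x v = 0" and xS: "\<forall>y\<in>S'. x y = 0" for x
  proof -
    have sum0: "(\<Sum>w\<in>C. x w) = 0" using eqv[of x] x branch_self[of v u] xu xv by simp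
    obtain w0 where w0: "J - K \<subseteq> {w0}" using Kex by blast
    have others: "x w = 0" if "w \<in> C" "w \<noteq> w0" for w
    proof (cases "w \<in> J")
      case True
      then have "w \<in> S'" using w0 that by (auto simp: S'_def)
      then show ?thesis using xS by blast
    next
      case False
      then show ?thesis using finite_zero[OF x _ xv] that by blast
    qed
    have all0: "x w = 0" if "w \<in> C" for w
    proof (cases "w = w0")
      case True
      have "(\<Sum>w\<in>C. x w) = x w0 + (\<Sum>w\<in>C - {w0}. x w)"
        using that True by (intro sum.remove) auto
      also have "(\<Sum>w\<in>C - {w0}. x w) = 0" using others by (intro sum.neutral) auto
      finally show ?thesis using sum0 True by simp
    qed (use that others in blast)
    have "x y = 0" if y: "y \<in> branch v w" "w \<in> C" for y w
    proof -
      have "\<forall>y\<in>S w. x y = 0" using xS y(2) by (auto simp: S'_def)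
      then show ?thesis using zero[OF x y(2) xv all0[OF y(2)]] y(1) by blast
    qed
    then show ?thesis unfolding Brv using xv by auto
  qed
  show ?case
    unfolding C_def[symmetric]
    using bound S'_sub relation vanish by blast
qed

end

section \<open>Classification of branches\<close>

text \<open>The second assumption excludes a pendant path \<open>p\<close>, \<open>q\<close>,
  \<open>c\<close> hung at \<open>v\<close>; its alternatives cover the cases where
  \<open>{p, c}\<close> or \<open>{q, v}\<close> collapses to a singleton.\<close>

locale reduced_tree = tree T for T :: "'v::finite ugraph" +
  assumes leaf_unique: "p \<in> nbrs v \<Longrightarrow> p' \<in> nbrs v \<Longrightarrow> card (nbrs p) = 1 \<Longrightarrow> card (nbrs p') = 1 \<Longrightarrow> p = p'"
    and no_pendant_P3: "nbrs p = {q} \<Longrightarrow> nbrs q = {p, c} \<Longrightarrow> nbrs c = {q, v} \<Longrightarrow> p = c \<or> v = q"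
begin

abbreviation leaf :: "'v \<Rightarrow> bool" where "leaf v \<equiv> card (nbrs v) = 1"

text \<open>A pendant path on two vertices hung at \<open>u\<close>.\<close>

definition tip :: "'v \<Rightarrow> 'v \<Rightarrow> bool" where
  "tip u v \<longleftrightarrow> (\<exists>p. nbrs v = {u, p} \<and> p \<noteq> u \<and> leaf p)"

definition quasi :: "'v \<Rightarrow> bool" where
  "quasi v \<longleftrightarrow> (\<exists>p\<in>nbrs v. leaf p)"

text \<open>A graph of the family \<open>G1\<close> without the first two vertices of its path,
  rooted at the third. Each link adds the path vertices \<open>v\<close>, \<open>b\<close>,
  \<open>a\<close> and the pendant vertex \<open>p\<close>.\<close>

inductive chain :: "'v \<Rightarrow> 'v \<Rightarrow> bool" where
  chain_tip: "nbrs v = {u, p, q} \<Longrightarrow> distinct [u, p, q] \<Longrightarrow> leaf p \<Longrightarrow> tip v q \<Longrightarrow> chain u v"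
| chain_link: "nbrs v = {u, p, b} \<Longrightarrow> distinct [u, p, b] \<Longrightarrow> leaf p \<Longrightarrow> nbrs b = {v, a} \<Longrightarrow> a \<noteq> v \<Longrightarrow>
    nbrs a = {b, w} \<Longrightarrow> w \<noteq> b \<Longrightarrow> chain a w \<Longrightarrow> chain u v"

text \<open>A chain preceded by two path vertices; below a quasi-pendant vertex it prolongs the
  chain.\<close>

definition link :: "'v \<Rightarrow> 'v \<Rightarrow> bool" where
  "link u v \<longleftrightarrow> (\<exists>a w. nbrs v = {u, a} \<and> a \<noteq> u \<and> nbrs a = {v, w} \<and> w \<noteq> v \<and> chain a w)"

text \<open>\<open>G4\<close> with one of its three pendant paths cut off.\<close>

definition fork :: "'v \<Rightarrow> 'v \<Rightarrow> bool" where
  "fork u v \<longleftrightarrow> (\<exists>a b. nbrs v = {u, a, b} \<and> distinct [u, a, b] \<and> tip v a \<and> tip v b)"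

text \<open>The part of \<open>G5\<close> that hangs at one vertex of degree three through the
  middle vertex of the path \<open>a w b\<close>.\<close>

definition stem :: "'v \<Rightarrow> 'v \<Rightarrow> bool" where
  "stem u v \<longleftrightarrow> (\<exists>w. nbrs v = {u, w} \<and> w \<noteq> u \<and> fork v w)"

text \<open>
  The strongest bounds that survive the induction.  The exact values \<open>r = Some 1\<close> and \<open>r = Some 2\<close>
  matter because a child with these relations can make the relation of its parent \<open>None\<close>.
\<close>

definition plain :: "'v \<Rightarrow> 'v \<Rightarrow> real option \<Rightarrow> int \<Rightarrow> bool" where
  "plain u v r h \<longleftrightarrow> h \<ge> 5 \<and>
     (h = 5 \<longrightarrow> (r = Some 1 \<and> (\<exists>w. nbrs v = {u, w} \<and> w \<noteq> u \<and> chain v w)) \<or>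
                 (r = Some (1/2) \<and> fork u v)) \<and>
     (r = None \<longrightarrow> h \<ge> 6 \<and> h \<noteq> 7 \<and> (h = 6 \<longrightarrow> link u v)) \<and>
     (r = Some 1 \<longrightarrow> h \<noteq> 6) \<and>
     (r = Some 2 \<longrightarrow> h \<ge> 6 \<and> (h = 6 \<longrightarrow> stem u v)) \<and>
     (r = None \<and> card (nbrs v) \<ge> 3 \<longrightarrow> h \<ge> 9 \<and>
        (h = 9 \<longrightarrow> (\<exists>a b. nbrs v = {u, a, b} \<and> distinct [u, a, b] \<and> tip v a \<and> stem v b)))"

definition classified :: "'v \<Rightarrow> 'v \<Rightarrow> real option \<Rightarrow> int \<Rightarrow> bool" where
  "classified u v r h \<longleftrightarrow>
     (leaf v \<longrightarrow> r = None \<and> h = 1) \<and>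
     (tip u v \<longrightarrow> r = Some 0 \<and> h = 2) \<and>
     (\<not> leaf v \<and> quasi v \<and> \<not> tip u v \<longrightarrow> r = Some 0 \<and> h \<ge> 4 \<and> h \<noteq> 5 \<and> (h = 4 \<longrightarrow> chain u v)) \<and>
     (\<not> leaf v \<and> \<not> quasi v \<longrightarrow> plain u v r h)"

lemma excess_no_None:
  assumes "\<And>w. w \<in> C \<Longrightarrow> r w \<noteq> None"
  shows "excess r h C = 1 + sum h C"
proof -
  have "{w \<in> C. r w = None} = {}" using assms by blast
  then have "card {w \<in> C. r w = None} = 0" by (simp only: card.empty)
  then show ?thesis unfolding excess_def by simp
qed

lemma not_leaf_if: "u \<in> nbrs v \<Longrightarrow> w \<in> nbrs v \<Longrightarrow> w \<noteq> u \<Longrightarrow> \<not> leaf v"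
  by (metis card_1_singletonE singletonD)

lemma child_cases:
  assumes "classified v w r h" "\<not> leaf w"
  obtains "tip v w" "r = Some 0" "h = 2"
  | "r = Some 0" "h \<ge> 4" "h \<noteq> 5" "h = 4 \<longrightarrow> chain v w" "\<not> tip v w"
  | "plain v w r h" "\<not> tip v w"
  using assms unfolding classified_def tip_def quasi_def by blast

text \<open>The leaf \<open>p\<close> forces \<open>x v = 0\<close>. Every other child has net
  weight at least 2, never 3, and 2 only for a tip or a link: relation \<open>None\<close> costs 4
  but comes with excess at least 6 and different from 7. The vertices \<open>v\<close> and
  \<open>p\<close> add 2.\<close>

lemma classified_quasi:
  assumes u: "u \<in> nbrs v" "\<not> leaf u" and p: "p \<in> nbrs v" "leaf p" and nt: "\<not> tip u v"
    and IH: "\<And>w. w \<in> nbrs v - {u} \<Longrightarrow> classified v w (r w) (h w)"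
  shows "slope r (nbrs v - {u}) = Some 0" "excess r h (nbrs v - {u}) \<ge> 4" "excess r h (nbrs v - {u}) \<noteq> 5"
    "excess r h (nbrs v - {u}) = 4 \<Longrightarrow> chain u v"
proof -
  define C where "C = nbrs v - {u}"
  define C' where "C' = C - {p}"
  have pu: "p \<noteq> u" using u p by auto
  have pC: "p \<in> C" using p pu by (simp add: C_def)
  have rp: "r p = None" "h p = 1" using IH[of p] p pu by (auto simp: classified_def)
  show "slope r (nbrs v - {u}) = Some 0" using pC rp unfolding C_def by (auto simp: slope_def)
  have nl: "\<not> leaf w" if "w \<in> C'" for w
    using leaf_unique[of w v p] that p by (auto simp: C'_def C_def)
  (* The leaf p already accounts for one child with relation None, so every other such child costs 4. *)
  define g where "g w = h w - (if r w = None then 4 else 0)" for w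
  have g: "g w \<ge> 2 \<and> g w \<noteq> 3 \<and> (g w = 2 \<longrightarrow> tip v w \<or> link v w)" if "w \<in> C'" for w
  proof -
    have "classified v w (r w) (h w)" using IH that by (auto simp: C'_def C_def)
    then show ?thesis
      by (rule child_cases[OF _ nl[OF that]]) (auto simp: g_def plain_def)
  qed
  have J: "{w \<in> C. r w = None} = insert p {w \<in> C'. r w = None}" "p \<notin> {w \<in> C'. r w = None}"
    using pC rp by (auto simp: C'_def)
  have "sum h C = 1 + sum h C'" using pC rp by (simp add: C'_def sum.remove)
  moreover have "sum g C' = sum h C' - 4 * int (card {w \<in> C'. r w = None})"
    unfolding g_def sum_subtractf by (simp add: sum.If_cases Int_def)
  moreover have "card {w \<in> C. r w = None} - 1 = card {w \<in> C'. r w = None}"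
    using J by simp
  ultimately have ex: "excess r h C = 2 + sum g C'" by (simp add: excess_def)
  have ne: "C' \<noteq> {}"
  proof
    assume "C' = {}"
    then have "nbrs v = {u, p}" using u p by (auto simp: C'_def C_def)
    then show False using nt p pu by (auto simp: tip_def)
  qed
  \<comment> \<open>Two or more children contribute at least 4, so the values below 4 come from a
    single child.\<close>
  have "sum g C' \<ge> 2 \<and> sum g C' \<noteq> 3 \<and> (sum g C' = 2 \<longrightarrow> (\<exists>w. C' = {w} \<and> (tip v w \<or> link v w)))"
  proof (cases "card C' = 1")
    case True
    then obtain w where "C' = {w}" by (auto simp: card_1_singleton_iff)
    then show ?thesis using g[of w] by simp
  next
    case False
    then have "card C' \<ge> 2" using ne by (metis One_nat_def Suc_leI card_gt_0_iff finite le_neq_implies_less numeral_2_eq_2)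
    moreover have "int (card C') * 2 \<le> sum g C'"
      using sum_bounded_below[of C' 2 g] g by simp
    ultimately show ?thesis by linarith
  qed
  moreover have "chain u v" if "C' = {w}" "tip v w \<or> link v w" for w
  proof -
    have w: "nbrs v = {u, p, w}" "distinct [u, p, w]" using that(1) u p pu by (auto simp: C'_def C_def)
    from that(2) show ?thesis
    proof
      assume "tip v w" then show ?thesis using w p chain_tip by blast
    next
      assume "link v w" then show ?thesis using w p chain_link unfolding link_def by blast
    qed
  qed
  ultimately show "excess r h (nbrs v - {u}) \<ge> 4" "excess r h (nbrs v - {u}) \<noteq> 5"
    "excess r h (nbrs v - {u}) = 4 \<Longrightarrow> chain u v"
    using ex unfolding C_def by auto
qed

text \<open>If \<open>j\<close> children have relation \<open>None\<close>, each has excess at least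
  6 and \<open>j - 1\<close> parameters are new, so the excess is at least
  \<open>1 + 6 * j - 4 * (j - 1)\<close>, which is at least 7. With relation \<open>Some 0\<close>
  this is beyond all critical values.\<close>

lemma plain_None:
  assumes IH: "\<And>w. w \<in> nbrs v - {u} \<Longrightarrow> classified v w (r w) (h w)"
    and nl: "\<And>w. w \<in> nbrs v - {u} \<Longrightarrow> \<not> leaf w"
    and J: "\<exists>w\<in>nbrs v - {u}. r w = None"
  shows "plain u v (slope r (nbrs v - {u})) (excess r h (nbrs v - {u}))"
proof -
  define C where "C = nbrs v - {u}"
  define J where "J = {w \<in> C. r w = None}"
  have h: "h w \<ge> (if w \<in> J then 6 else 0)" if "w \<in> C" for w
    using that unfolding C_def by - (rule child_cases[OF IH[of w] nl[of w]]; auto simp: J_def plain_def)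
  have "int (card J) * 6 = (\<Sum>w\<in>C. if w \<in> J then 6 else 0)"
    by (simp add: sum.If_cases J_def Int_def)
  also have "\<dots> \<le> sum h C" using h by (intro sum_mono)
  finally have "sum h C \<ge> 6 * int (card J)" by simp
  moreover have "card J > 0" using J by (auto simp: J_def C_def card_gt_0_iff)
  ultimately have "excess r h C \<ge> 7" by (simp add: excess_def J_def[symmetric])
  moreover have "slope r C = Some 0" using J by (auto simp: slope_def C_def)
  ultimately show ?thesis unfolding C_def by (simp add: plain_def)
qed

lemma plain_one:
  assumes u: "u \<in> nbrs v" "\<not> leaf u" and C: "nbrs v - {u} = {w}" and nl: "\<not> leaf w"
    and IH: "classified v w (r w) (h w)" and nN: "r w \<noteq> None"
  shows "plain u v (slope r {w}) (excess r h {w})"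
proof -
  have Nv: "nbrs v = {u, w}" "w \<noteq> u" using u C by auto
  have card2: "card (nbrs v) = 2" using Nv by simp
  obtain a where a: "r w = Some a" using nN by auto
  have sl: "slope r {w} = (if a = 1 then None else Some (1 / (1 - a)))" by (simp add: slope_def a)
  have ex: "excess r h {w} = 1 + h w" using excess_no_None[of "{w}" r h] nN by simp
  show ?thesis
  proof (rule child_cases[OF IH nl])
    assume "tip v w"
    then obtain p where p: "nbrs w = {v, p}" "p \<noteq> v" "leaf p" by (auto simp: tip_def)
    have "w \<in> nbrs p" using p nbrs_sym by blast
    then have "nbrs p = {w}" using p(3) by (auto simp: card_1_singleton_iff)
    \<comment> \<open>Below a single child that is a tip, the vertices \<open>p\<close>,
      \<open>w\<close>, \<open>v\<close> would form a pendant path on three vertices at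
      \<open>u\<close>.\<close>
    then have "p = v \<or> u = w" using no_pendant_P3[of p w v u] p Nv by (simp add: insert_commute)
    then show ?thesis using p Nv by simp
  next
    assume *: "r w = Some 0" "h w \<ge> 4" "h w \<noteq> 5" "h w = 4 \<longrightarrow> chain v w"
    then show ?thesis using a sl ex Nv by (auto simp: plain_def)
  next
    assume i: "plain v w (r w) (h w)"
    \<comment> \<open>The excess grows by one, and slope \<open>a\<close> turns into
      \<open>None\<close> for 1, into 2 for 1/2 and into 1 for 0. So the two extremal children of
      excess 5 give a link and a stem, and the ban on \<open>Some 1\<close> with excess 6 becomes
      the ban on \<open>None\<close> with 7.\<close>
    have "link u v" if "a = 1" "h w = 5" 
      using i that a Nv by (auto simp: plain_def link_def)
    moreover have "stem u v" if "a = 1/2" "h w = 5" 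
      using i that a Nv by (auto simp: plain_def stem_def)
    moreover have "1 / (1 - a) = 1 \<longleftrightarrow> a = 0" "1 / (1 - a) = 2 \<longleftrightarrow> a = 1/2" if "a \<noteq> 1"
      using that by (auto simp: field_simps)
    ultimately show ?thesis using i a sl ex card2 by (auto simp: plain_def)
  qed
qed

text \<open>Two tips give a fork of excess 5; all other pairs give at least 7. Relation
  \<open>None\<close> means that the slopes add up to 2: a tip then needs a plain sibling of slope
  2, whence \<open>1 + 2 + 6 = 9\<close> with a stem at equality, and the remaining pairs involving
  a plain child have at least 10.\<close>

lemma plain_two:
  assumes u: "u \<in> nbrs v" and C: "nbrs v - {u} = {a, b}" "a \<noteq> b"
    and nl: "\<not> leaf a" "\<not> leaf b"
    and IH: "classified v a (r a) (h a)" "classified v b (r b) (h b)"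
    and nN: "r a \<noteq> None" "r b \<noteq> None"
  shows "plain u v (slope r {a, b}) (excess r h {a, b})"
proof -
  have Nv: "nbrs v = {u, a, b}" "distinct [u, a, b]" using u C by auto
  obtain x y where xy: "r a = Some x" "r b = Some y" using nN by auto
  have sl: "slope r {a, b} = (if x + y = 2 then None else Some (1 / (2 - (x + y))))"
    using C(2) by (simp add: slope_def xy)
  have "excess r h {a, b} = 1 + sum h {a, b}" by (rule excess_no_None) (use nN in auto)
  then have ex: "excess r h {a, b} = 1 + h a + h b" using C(2) by simp
  have half: "1 / (2 - (x + y)) = 1 \<longleftrightarrow> x + y = 1" "1 / (2 - (x + y)) = 2 \<longleftrightarrow> x + y = 3/2"
    if "x + y \<noteq> 2" using that by (auto simp: field_simps)
  have Nv': "nbrs v = {u, b, a}" "distinct [u, b, a]" using Nv by auto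
  note defs = sl ex half plain_def[of u v]
  show ?thesis
  proof (rule child_cases[OF IH(1) nl(1)]; rule child_cases[OF IH(2) nl(2)])
    assume "tip v a" "r a = Some 0" "h a = 2" "tip v b" "r b = Some 0" "h b = 2"
    then show ?thesis using Nv xy by (auto simp: defs fork_def)
  next
    assume *: "tip v a" "r a = Some 0" "h a = 2" "plain v b (r b) (h b)"
    then have "y = 2 \<Longrightarrow> h b \<ge> 6 \<and> (h b = 6 \<longrightarrow> stem v b)" using xy by (simp add: plain_def)
    moreover have "h b \<ge> 5" using * by (simp add: plain_def)
    ultimately show ?thesis using * Nv xy by (auto simp: defs)
  next
    assume *: "tip v b" "r b = Some 0" "h b = 2" "plain v a (r a) (h a)"
    then have "x = 2 \<Longrightarrow> h a \<ge> 6 \<and> (h a = 6 \<longrightarrow> stem v a)" using xy by (simp add: plain_def)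
    moreover have "h a \<ge> 5" using * by (simp add: plain_def)
    ultimately show ?thesis using * Nv' xy by (auto simp: defs)
  next
    assume *: "r a = Some 0" "h a \<ge> 4" "plain v b (r b) (h b)"
    then have "h b \<ge> 5" by (simp add: plain_def)
    then show ?thesis using * xy by (auto simp: defs)
  next
    assume *: "r b = Some 0" "h b \<ge> 4" "plain v a (r a) (h a)"
    then have "h a \<ge> 5" by (simp add: plain_def)
    then show ?thesis using * xy by (auto simp: defs)
  next
    assume *: "plain v a (r a) (h a)" "plain v b (r b) (h b)"
    then have "h a \<ge> 5" "h b \<ge> 5" by (simp_all add: plain_def)
    then show ?thesis by (auto simp: defs)
  qed (use xy in \<open>auto simp: defs\<close>)
qed

text \<open>Three children of excess at least 2 give 7. Relation \<open>None\<close> requires a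
  nonzero slope, hence a child of excess at least 5 and a total of at least
  \<open>1 + 5 + 2 * 2 = 10\<close>, beyond the critical 9.\<close>

lemma plain_many:
  assumes C: "card (nbrs v - {u}) \<ge> 3"
    and IH: "\<And>w. w \<in> nbrs v - {u} \<Longrightarrow> classified v w (r w) (h w)"
    and nl: "\<And>w. w \<in> nbrs v - {u} \<Longrightarrow> \<not> leaf w"
    and nN: "\<And>w. w \<in> nbrs v - {u} \<Longrightarrow> r w \<noteq> None"
  shows "plain u v (slope r (nbrs v - {u})) (excess r h (nbrs v - {u}))"
proof -
  define C where "C = nbrs v - {u}"
  have h2: "h w \<ge> 2" if "w \<in> C" for w
    using that unfolding C_def by - (rule child_cases[OF IH[of w] nl[of w]]; auto simp: plain_def)
  have h5: "h w \<ge> 5" if "w \<in> C" "the (r w) \<noteq> 0" for w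
    using that unfolding C_def by - (rule child_cases[OF IH[of w] nl[of w]]; auto simp: plain_def)
  have ex: "excess r h C = 1 + sum h C" using nN unfolding C_def by (intro excess_no_None)
  have "int (card C) * 2 \<le> sum h C" using sum_bounded_below[of C 2 h] h2 by simp
  then have e7: "excess r h C \<ge> 7" using ex C unfolding C_def by linarith
  have e10: "excess r h C \<ge> 10" if "slope r C = None"
  proof -
    have "(\<Sum>w\<in>C. the (r w)) = real (card C)"
      using that nN by (auto simp: slope_def C_def split: if_splits)
    then have "(\<Sum>w\<in>C. the (r w)) \<noteq> 0" using C unfolding C_def by linarith
    then obtain w where w: "w \<in> C" "the (r w) \<noteq> 0" by (meson sum.neutral)
    have "sum h C = h w + sum h (C - {w})" using w by (simp add: sum.remove)
    moreover have "int (card (C - {w})) * 2 \<le> sum h (C - {w})"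
      using sum_bounded_below[of "C - {w}" 2 h] h2 by simp
    moreover have "card (C - {w}) \<ge> 2" using w C by (simp add: C_def card_Diff_singleton_if)
    ultimately show ?thesis using h5[OF w] ex by linarith
  qed
  show ?thesis using e7 e10 unfolding C_def by (auto simp: plain_def)
qed

text \<open>\<open>quasi\<close> looks at all neighbours; with a non-leaf parent the leaf in
  question is a child. This hypothesis passes on to the children, since a vertex with parent and
  child is not a leaf.\<close>

lemma classified_branch_value:
  assumes "branch_value u v r h" "\<not> leaf u"
  shows "classified u v r h"
  using assms
proof (induction rule: branch_value.induct)
  case (branch_value u v r h)
  define C where "C = nbrs v - {u}"
  note uv = branch_value.hyps(1)
  have IH: "classified v w (r w) (h w)" if "w \<in> C" for w
    using branch_value.IH[of w] not_leaf_if[OF uv, of w] that by (auto simp: C_def)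
  have cardN: "card (nbrs v) = Suc (card C)"
    using uv unfolding C_def by (metis card_Suc_Diff1 finite)
  \<comment> \<open>The equation at a leaf reads \<open>x u = 0\<close>; in \<open>slope\<close> the
    empty sum equals the cardinality 0.\<close>
  have leaf_case: "slope r C = None \<and> excess r h C = 1" if "leaf v"
    using that cardN by (simp add: slope_def excess_def)
  have tip_case: "slope r C = Some 0 \<and> excess r h C = 2" if "tip u v"
  proof -
    obtain p where p: "nbrs v = {u, p}" "p \<noteq> u" "leaf p" using \<open>tip u v\<close> unfolding tip_def by blast
    then have "C = {p}" by (auto simp: C_def)
    moreover have "r p = None" "h p = 1" using IH[of p] p calculation by (auto simp: classified_def)
    moreover have "{w \<in> {p}. r w = None} = {p}" using calculation by auto
    ultimately show ?thesis by (simp add: slope_def excess_def)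
  qed
  have quasi_case: "slope r C = Some 0 \<and> excess r h C \<ge> 4 \<and> excess r h C \<noteq> 5 \<and>
      (excess r h C = 4 \<longrightarrow> chain u v)" if "quasi v" "\<not> tip u v"
  proof -
    obtain p where p: "p \<in> nbrs v" "leaf p" using \<open>quasi v\<close> by (auto simp: quasi_def)
    show ?thesis
      using classified_quasi[OF uv branch_value.prems p that(2), of r h] IH unfolding C_def by blast
  qed
  have plain_case: "plain u v (slope r C) (excess r h C)" if v: "\<not> leaf v" "\<not> quasi v"
  proof -
    have nl: "\<not> leaf w" if "w \<in> C" for w using v that by (auto simp: quasi_def C_def)
    show ?thesis
    proof (cases "\<exists>w\<in>C. r w = None")
      case True
      then show ?thesis using plain_None[of v u r h] IH nl unfolding C_def by blast
    next
      case False
      consider "card C = 0" | "card C = 1" | "card C = 2" | "card C \<ge> 3" by linarith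
      then show ?thesis
      proof cases
        case 1
        then show ?thesis using v(1) cardN by simp
      next
        case 2
        then obtain w where w: "C = {w}" by (auto simp: card_1_singleton_iff)
        then show ?thesis
          using plain_one[OF uv branch_value.prems, of w r h] IH[of w] nl[of w] False unfolding C_def by auto
      next
        case 3
        then obtain a b where ab: "C = {a, b}" "a \<noteq> b" by (auto simp: card_2_iff)
        then show ?thesis
          using plain_two[OF uv, of a b r h] IH[of a] IH[of b] nl[of a] nl[of b] False
          unfolding C_def by auto
      next
        case 4
        have nN: "r w \<noteq> None" if "w \<in> C" for w using that False by auto
        show ?thesis unfolding C_def
          by (rule plain_many) (fact 4[unfolded C_def] IH[unfolded C_def] nl[unfolded C_def] nN[unfolded C_def])+
      qed
    qed
  qed
  show ?case
    unfolding classified_def C_def[symmetric]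
    using leaf_case tip_case quasi_case plain_case by blast
qed

end

section \<open>Recognising the exceptional trees\<close>

lemma path_edges_image: "path_edges p = (\<lambda>i. {p ! i, p ! Suc i}) ` {i. Suc i < length p}"
  by (auto simp: path_edges_def)

lemma path_edges_single [simp]: "path_edges [x] = {}"
  by (simp add: path_edges_def)

lemma path_edges_Cons [simp]: "path_edges (x # y # zs) = insert {x, y} (path_edges (y # zs))"
proof -
  have "{i. Suc i < length (x # y # zs)} = insert 0 (Suc ` {i. Suc i < length (y # zs)})"
    by (auto simp: image_iff) (metis Suc_less_eq not0_implies_Suc)
  then show ?thesis unfolding path_edges_image by (simp add: image_image)
qed

text \<open>The list \<open>xs\<close> starts at a vertex that carries a pendant vertex, so the
  positions are 0, 3, 6 and so on; in \<open>G1\<close> two more path vertices precede.\<close>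

definition rungs :: "'a list \<Rightarrow> 'a list \<Rightarrow> 'a set set" where
  "rungs xs ps = (\<lambda>i. {xs ! (3 * i), ps ! i}) ` {..<length ps}"

lemma rungs_Nil [simp]: "rungs xs [] = {}"
  by (simp add: rungs_def)

lemma rungs_Cons [simp]: "rungs (v # b # a # xs) (p # ps) = insert {v, p} (rungs xs ps)"
  by (simp add: rungs_def lessThan_Suc_eq_insert_0 image_image)

lemma verts_G4: "verts G4 = {..<7}"
  unfolding G4_def attach_path_def path_graph_def
  by (simp add: lessThan_nat_numeral lessThan_Suc insert_commute)

lemma verts_G5: "verts G5 = {..<11}"
  unfolding G5_def attach_path_def path_graph_def
  by (simp add: lessThan_nat_numeral lessThan_Suc insert_commute)

lemma edges_G4: "edges G4 = {{0, 1}, {1, 2}, {0, 3}, {3, 4}, {0, 5}, {5, 6}}"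
  unfolding G4_def attach_path_def path_graph_def
  by (simp add: insert_commute)

lemma edges_G5: "edges G5 = {{0, 1}, {1, 2}, {0, 3}, {3, 4}, {0, 5}, {5, 6},
    {2, 7}, {7, 8}, {2, 9}, {9, 10}}"
  unfolding G5_def attach_path_def path_graph_def
  by (simp add: insert_commute)

context tree
begin

lemma card_UNIV_rec: "card (UNIV :: 'v set) = 1 + (\<Sum>w\<in>nbrs v. card (branch v w))"
proof -
  have "v \<notin> (\<Union>w\<in>nbrs v. branch v w)" using parent_notin_branch by blast
  moreover have "card (\<Union>w\<in>nbrs v. branch v w) = (\<Sum>w\<in>nbrs v. card (branch v w))"
    by (rule card_UN_disjoint) (simp_all add: branch_disjoint)
  ultimately show ?thesis by (subst UNIV_rec[of v]) simp
qed

text \<open>A list that covers the type and has its cardinality as length is distinct. The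
  cardinality comes from the recursion over branches, which replaces pairwise comparison of
  vertices.\<close>

lemma iso_of_list:
  assumes zs: "set zs = (UNIV :: 'v set)" "length zs = card (UNIV :: 'v set)"
    and H: "bij_betw g (verts H) {..<length zs}" "\<And>e. e \<in> edges H \<Longrightarrow> e \<subseteq> verts H"
    and E: "edges T = (`) (\<lambda>i. zs ! g i) ` edges H"
  shows "T \<cong>\<^sub>g H"
proof (rule graph_isoI[OF _ E H(2)])
  have "distinct zs" using zs by (simp add: card_distinct)
  then have "bij_betw ((!) zs) {..<length zs} (verts T)"
    using zs verts_UNIV by (intro bij_betw_nth) auto
  from bij_betw_trans[OF H(1) this] show "bij_betw (\<lambda>i. zs ! g i) (verts H) (verts T)"
    by (simp add: o_def)
qed

end

context reduced_tree
begin

lemma leaf_nbrs: "leaf v \<Longrightarrow> u \<in> nbrs v \<Longrightarrow> nbrs v = {u}"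
  by (auto simp: card_1_singleton_iff)

lemma leaf_branch:
  assumes "leaf v" "u \<in> nbrs v"
  shows "branch u v = {v}" "branch_edges u v = {}"
  using branch_rec[OF assms(2)] branch_edges_rec[OF assms(2)] leaf_nbrs[OF assms] by auto

lemma tip_branch:
  assumes "tip u v"
  obtains p where "branch u v = {v, p}" "card (branch u v) = 2" "branch_edges u v = {{v, p}}"
proof -
  obtain p where p: "nbrs v = {u, p}" "p \<noteq> u" "leaf p" using assms unfolding tip_def by blast
  have uv: "u \<in> nbrs v" and C: "nbrs v - {u} = {p}" using p by auto
  have vp: "v \<in> nbrs p" using p nbrs_sym by blast
  show thesis
    using branch_rec[OF uv] branch_edges_rec[OF uv] card_branch_rec[OF uv] leaf_branch[OF p(3) vp]
    unfolding C by (intro that[of p]) auto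
qed

lemma fork_branch:
  assumes "fork u v"
  obtains a a' b b' where "branch u v = {v, a, a', b, b'}" "card (branch u v) = 5"
    "branch_edges u v = {{v, a}, {a, a'}, {v, b}, {b, b'}}"
proof -
  obtain a b where ab: "nbrs v = {u, a, b}" "distinct [u, a, b]" "tip v a" "tip v b"
    using assms unfolding fork_def by blast
  have uv: "u \<in> nbrs v" and C: "nbrs v - {u} = {a, b}" using ab by auto
  obtain a' where a': "branch v a = {a, a'}" "card (branch v a) = 2" "branch_edges v a = {{a, a'}}"
    using tip_branch[OF ab(3)] .
  obtain b' where b': "branch v b = {b, b'}" "card (branch v b) = 2" "branch_edges v b = {{b, b'}}"
    using tip_branch[OF ab(4)] .
  show thesis
  proof (rule that[of a a' b b'])
    show "branch u v = {v, a, a', b, b'}" 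
      using branch_rec[OF uv] unfolding C by (simp add: a'(1) b'(1) insert_commute)
    show "card (branch u v) = 5" using card_branch_rec[OF uv] ab(2) unfolding C by (simp add: a'(2) b'(2))
    show "branch_edges u v = {{v, a}, {a, a'}, {v, b}, {b, b'}}"
      using branch_edges_rec[OF uv] unfolding C by (simp add: a'(3) b'(3) insert_commute)
  qed
qed

text \<open>Both lists grow at the front: a tip closes the path with \<open>v\<close>,
  \<open>q\<close>, \<open>q'\<close>, and each link prepends \<open>v\<close>, \<open>b\<close>,
  \<open>a\<close> to \<open>xs\<close> and \<open>p\<close> to \<open>ps\<close>.\<close>

lemma chain_branch:
  assumes "chain u v"
  shows "\<exists>xs ps. branch u v = set (xs @ ps) \<and> card (branch u v) = length (xs @ ps) \<and>
    branch_edges u v = path_edges xs \<union> rungs xs ps \<and> xs \<noteq> [] \<and> hd xs = v \<and>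
    length xs = 3 * length ps \<and> ps \<noteq> []"
  using assms
proof (induction rule: chain.induct)
  case (chain_tip v u p q)
  have uv: "u \<in> nbrs v" and C: "nbrs v - {u} = {p, q}" and pq: "p \<noteq> q" and vp: "v \<in> nbrs p"
    using chain_tip nbrs_sym by auto
  obtain q' where q': "branch v q = {q, q'}" "card (branch v q) = 2" "branch_edges v q = {{q, q'}}"
    using tip_branch[OF chain_tip(4)] .
  note p' = leaf_branch[OF chain_tip(3) vp]
  have "branch u v = set ([v, q, q'] @ [p])" using branch_rec[OF uv] unfolding C
    by (simp add: p' q'(1) insert_commute)
  moreover have "card (branch u v) = 4" using card_branch_rec[OF uv] pq unfolding C by (simp add: p' q'(2))
  moreover have "branch_edges u v = path_edges [v, q, q'] \<union> rungs [v, q, q'] [p]"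
    using branch_edges_rec[OF uv] unfolding C by (simp add: p' q' insert_commute)
  ultimately show ?case by (intro exI[of _ "[v, q, q']"] exI[of _ "[p]"]) simp
next
  case (chain_link v u p b a w)
  then obtain xs ps where X: "branch a w = set (xs @ ps)" "card (branch a w) = length (xs @ ps)"
    "branch_edges a w = path_edges xs \<union> rungs xs ps" "xs \<noteq> []" "hd xs = w"
    "length xs = 3 * length ps" "ps \<noteq> []" by blast
  have uv: "u \<in> nbrs v" and C: "nbrs v - {u} = {p, b}" and pb: "p \<noteq> b" and vp: "v \<in> nbrs p"
    and vb: "v \<in> nbrs b" and Cb: "nbrs b - {v} = {a}" and ba: "b \<in> nbrs a" and Ca: "nbrs a - {b} = {w}"
    using chain_link nbrs_sym by auto
  note p' = leaf_branch[OF chain_link(3) vp]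
  have branch: "branch u v = insert v (insert p (insert b (insert a (branch a w))))"
    using branch_rec[OF uv] branch_rec[OF vb] branch_rec[OF ba] unfolding C Cb Ca by (simp add: p' insert_commute)
  have card: "card (branch u v) = card (branch a w) + 4"
    using card_branch_rec[OF uv] card_branch_rec[OF vb] card_branch_rec[OF ba] pb unfolding C Cb Ca
    by (simp add: p')
  have branch_edges: "branch_edges u v = {{v, p}, {v, b}, {b, a}, {a, w}} \<union> branch_edges a w"
    using branch_edges_rec[OF uv] branch_edges_rec[OF vb] branch_edges_rec[OF ba] unfolding C Cb Ca by (simp add: p' insert_commute)
  obtain ys where ys: "xs = w # ys" using X by (cases xs) auto
  have "path_edges (v # b # a # xs) = {{v, b}, {b, a}, {a, w}} \<union> path_edges xs"
    unfolding ys by auto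
  then have "branch_edges u v = path_edges (v # b # a # xs) \<union> rungs (v # b # a # xs) (p # ps)"
    using branch_edges X(3) by (simp add: insert_commute)
  moreover have "branch u v = set ((v # b # a # xs) @ (p # ps))" using branch X(1) by (simp add: insert_commute)
  moreover have "card (branch u v) = length ((v # b # a # xs) @ (p # ps))" using card X(2) by simp
  ultimately show ?case
    using X by (intro exI[of _ "v # b # a # xs"] exI[of _ "p # ps"]) simp
qed

lemma root_split:
  assumes "nbrs q = {p, w}" "p \<noteq> w" "leaf p"
  shows "UNIV = insert q (insert p (branch q w))" "card (UNIV :: 'v set) = card (branch q w) + 2"
    "edges T = {{q, p}, {q, w}} \<union> branch_edges q w"
proof -
  have "q \<in> nbrs p" using assms nbrs_sym by blast
  note p' = leaf_branch[OF assms(3) this]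
  show "UNIV = insert q (insert p (branch q w))" using UNIV_rec[of q] assms(1) by (simp add: p')
  show "card (UNIV :: 'v set) = card (branch q w) + 2" using card_UNIV_rec[of q] assms by (simp add: p')
  show "edges T = {{q, p}, {q, w}} \<union> branch_edges q w" using edges_rec[of q] assms(1) by (simp add: p' insert_commute)
qed

lemma chain_iso_G1:
  assumes q: "nbrs q = {p, w}" "p \<noteq> w" "leaf p" and ch: "chain q w"
  shows "\<exists>l\<ge>1. T \<cong>\<^sub>g G1 l"
proof -
  obtain xs ps where X: "branch q w = set (xs @ ps)" "card (branch q w) = length (xs @ ps)"
    "branch_edges q w = path_edges xs \<union> rungs xs ps" "xs \<noteq> []" "hd xs = w"
    "length xs = 3 * length ps" "ps \<noteq> []" using chain_branch[OF ch] by blast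
  define l where "l = length ps"
  \<comment> \<open>The leaf \<open>p\<close> and the root \<open>q\<close> are the first two path
    vertices of \<open>G1\<close>.\<close>
  define ys where "ys = p # q # xs"
  define zs where "zs = ys @ ps"
  \<comment> \<open>\<open>G1\<close> numbers its vertices from 1, lists from 0.\<close>
  define F where "F k = zs ! (k - 1)" for k
  have len: "length ys = 3 * l + 2" "length ps = l" "length zs = 4 * l + 2"
    using X by (simp_all add: ys_def zs_def l_def)
  have path: "path_edges ys = {{q, p}, {q, w}} \<union> path_edges xs"
    using X(4,5) by (cases xs) (auto simp: ys_def insert_commute)
  have E: "edges T = path_edges ys \<union> rungs xs ps"
    using root_split(3)[OF q] X(3) path by auto
  have F_path: "F k = ys ! (k - 1)" if "k \<in> {1..3 * l + 2}" for k
  proof -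
    have "k - 1 < length ys" using that len by auto
    then show ?thesis by (simp add: F_def zs_def nth_append)
  qed
  have F_pend: "F (3 * l + 2 + i) = ps ! (i - 1)" if "i \<ge> 1" for i
    using that len by (simp add: F_def zs_def nth_append)
  have p1: "path_edges [1..<3 * l + 3] = (\<lambda>i. {Suc i, Suc (Suc i)}) ` {i. Suc i < 3 * l + 2}"
    unfolding path_edges_image by (intro image_cong) (auto simp: nth_append)
  have "(`) F ` path_edges [1..<3 * l + 3] = (\<lambda>i. {ys ! i, ys ! Suc i}) ` {i. Suc i < 3 * l + 2}"
    unfolding p1 image_image by (intro image_cong) (simp_all add: F_path)
  also have "\<dots> = path_edges ys" by (simp add: path_edges_image len)
  finally have im1: "(`) F ` path_edges [1..<3 * l + 3] = path_edges ys" .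
  have p2: "{{3 * i, 3 * l + 2 + i} | i. i \<in> {1..l}} =
      (\<lambda>i. {3 * Suc i, 3 * l + 2 + Suc i}) ` {..<l}"
  proof -
    have "{{3 * i, 3 * l + 2 + i} | i. i \<in> {1..l}} = (\<lambda>i. {3 * i, 3 * l + 2 + i}) ` Suc ` {..<l}"
      unfolding image_Suc_lessThan by blast
    then show ?thesis by (simp only: image_image)
  qed
  have "(`) F ` {{3 * i, 3 * l + 2 + i} | i. i \<in> {1..l}} = (\<lambda>i. {xs ! (3 * i), ps ! i}) ` {..<l}"
    unfolding p2 image_image
  proof (intro image_cong refl)
    fix i assume "i \<in> {..<l}"
    then have "F (3 * Suc i) = xs ! (3 * i)" by (subst F_path) (auto simp: ys_def)
    then show "F ` {3 * Suc i, 3 * l + 2 + Suc i} = {xs ! (3 * i), ps ! i}"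
      using F_pend[of "Suc i"] by simp
  qed
  then have im2: "(`) F ` {{3 * i, 3 * l + 2 + i} | i. i \<in> {1..l}} = rungs xs ps"
    by (simp add: rungs_def l_def)
  have "T \<cong>\<^sub>g G1 l"
  proof (rule iso_of_list[of zs "\<lambda>k. k - 1"])
    show "set zs = UNIV" using root_split(1)[OF q] X(1) by (auto simp: zs_def ys_def)
    show "length zs = card (UNIV :: 'v set)"
      using root_split(2)[OF q] X(2) by (simp add: zs_def ys_def)
    show "bij_betw (\<lambda>k. k - 1) (verts (G1 l)) {..<length zs}"
      by (rule bij_betwI[of _ _ _ Suc]) (auto simp: G1_def len)
    show "e \<subseteq> verts (G1 l)" if "e \<in> edges (G1 l)" for e
      using that unfolding G1_def p1 by auto
    show "edges T = (`) (\<lambda>i. zs ! (i - 1)) ` edges (G1 l)"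
      using im1 im2 E by (simp add: G1_def image_Un F_def[abs_def])
  qed
  moreover have "l \<ge> 1" using X by (simp add: l_def Suc_le_eq)
  ultimately show ?thesis by blast
qed

text \<open>The root \<open>q\<close> and its leaf \<open>p\<close> form the third pendant path at
  the centre \<open>w\<close>.\<close>

lemma fork_iso_G4:
  assumes q: "nbrs q = {p, w}" "p \<noteq> w" "leaf p" and f: "fork q w"
  shows "T \<cong>\<^sub>g G4"
proof -
  obtain a a' b b' where B: "branch q w = {w, a, a', b, b'}" "card (branch q w) = 5"
    "branch_edges q w = {{w, a}, {a, a'}, {w, b}, {b, b'}}" using fork_branch[OF f] .
  show ?thesis
  proof (rule iso_of_list[of "[w, q, p, a, a', b, b']" id])
    show "set [w, q, p, a, a', b, b'] = UNIV" using root_split(1)[OF q] B(1) by (simp add: insert_commute)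
    show "length [w, q, p, a, a', b, b'] = card (UNIV :: 'v set)"
      using root_split(2)[OF q] B(2) by simp
    show "bij_betw id (verts G4) {..<length [w, q, p, a, a', b, b']}"
      by (simp add: verts_G4 bij_betw_def eval_nat_numeral)
    show "e \<subseteq> verts G4" if "e \<in> edges G4" for e
      using that by (auto simp: verts_G4 edges_G4)
    show "edges T = (`) (\<lambda>i. [w, q, p, a, a', b, b'] ! id i) ` edges G4"
      unfolding root_split(3)[OF q] B(3)
      by (simp add: edges_G4 insert_commute)
  qed
qed

lemma stem_iso_G5:
  assumes q: "nbrs q = {p, w}" "p \<noteq> w" "leaf p"
    and w: "nbrs w = {q, a, b}" "distinct [q, a, b]" "tip w a" "stem w b"
  shows "T \<cong>\<^sub>g G5"
proof -
  have qw: "q \<in> nbrs w" and C: "nbrs w - {q} = {a, b}" and ab: "a \<noteq> b" using w by auto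
  obtain a' where a': "branch w a = {a, a'}" "card (branch w a) = 2" "branch_edges w a = {{a, a'}}"
    using tip_branch[OF w(3)] .
  obtain d where d: "nbrs b = {w, d}" "d \<noteq> w" "fork b d" using w(4) unfolding stem_def by blast
  have wb: "w \<in> nbrs b" and Cb: "nbrs b - {w} = {d}" using d by auto
  obtain e e' f f' where B: "branch b d = {d, e, e', f, f'}" "card (branch b d) = 5"
    "branch_edges b d = {{d, e}, {e, e'}, {d, f}, {f, f'}}" using fork_branch[OF d(3)] .
  have branch_edges_wb: "branch_edges w b = {{b, d}, {d, e}, {e, e'}, {d, f}, {f, f'}}"
    using branch_edges_rec[OF wb] unfolding Cb by (simp add: B(3))
  \<comment> \<open>In the numbering of \<open>G5\<close>: \<open>w\<close>, \<open>b\<close>,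
    \<open>d\<close> is the path \<open>a w b\<close>; the root with its leaf and the tip hang at
    \<open>w\<close>, the two tips of the fork at \<open>d\<close>.\<close>
  let ?zs = "[w, b, d, q, p, a, a', e, e', f, f']"
  show ?thesis
  proof (rule iso_of_list[of ?zs id])
    show "set ?zs = UNIV"
      using root_split(1)[OF q] branch_rec[OF qw] branch_rec[OF wb] unfolding C Cb
      by (simp add: B(1) a'(1) insert_commute)
    show "length ?zs = card (UNIV :: 'v set)"
      using root_split(2)[OF q] card_branch_rec[OF qw] card_branch_rec[OF wb] ab
      unfolding C Cb by (simp add: B(2) a'(2))
    show "bij_betw id (verts G5) {..<length ?zs}"
      by (simp add: verts_G5 bij_betw_def eval_nat_numeral)
    show "e \<subseteq> verts G5" if "e \<in> edges G5" for e
      using that by (auto simp: verts_G5 edges_G5)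
    show "edges T = (`) (\<lambda>i. ?zs ! id i) ` edges G5"
      unfolding root_split(3)[OF q] branch_edges_rec[OF qw] C
      by (simp add: branch_edges_wb a'(3) edges_G5 insert_commute)
  qed
qed

end

section \<open>The multiplicity of the eigenvalue 1\<close>

context tree
begin

lemma eigenspace_1:
  "laplacian T *v x = 1 *\<^sub>R x \<longleftrightarrow> (\<forall>v. lapeq (\<lambda>i. x $ i) v)"
proof -
  have "(laplacian T *v x) $ v = real (card (nbrs v)) * x $ v - (\<Sum>w\<in>nbrs v. x $ w)" for v
  proof -
    have "(laplacian T *v x) $ v = (\<Sum>w\<in>UNIV. (if v = w then real (vdegree T v) * x $ w else 0) -
        (if w \<in> nbrs v then x $ w else 0))"
      unfolding laplacian_def degree_matrix_def adjacency_matrix_def matrix_vector_mult_def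
      by (auto simp: nbrs_def algebra_simps intro!: sum.cong)
    also have "\<dots> = real (vdegree T v) * x $ v - (\<Sum>w\<in>nbrs v. x $ w)"
      by (simp add: sum_subtractf sum.If_cases)
    also have "vdegree T v = card (nbrs v)" by (simp add: vdegree_def nbrs_def verts_UNIV)
    finally show ?thesis .
  qed
  then show ?thesis by (auto simp: vec_eq_iff lapeq_def algebra_simps)
qed

lemma lap_mult_le:
  assumes "\<And>x. (\<forall>v. lapeq x v) \<Longrightarrow> (\<forall>v\<in>S. x v = 0) \<Longrightarrow> x = (\<lambda>_. 0)"
  shows "lap_mult T 1 \<le> card S"
  unfolding lap_mult_def
proof (rule dim_le_card_zero_set)
  show "subspace {x. laplacian T *v x = 1 *\<^sub>R x}"
    by (auto simp: subspace_def matrix_vector_right_distrib matrix_vector_mult_scaleR)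
  fix x assume "x \<in> {x. laplacian T *v x = 1 *\<^sub>R x}" "\<forall>i\<in>S. x $ i = 0"
  then have "(\<lambda>i. x $ i) = (\<lambda>_. 0)" using assms[of "\<lambda>i. x $ i"] unfolding mem_Collect_eq eigenspace_1 by blast
  then show "x = 0" by (simp add: vec_eq_iff fun_eq_iff)
qed

lemma lap_mult_pos:
  assumes "\<forall>v. lapeq x v" "x v \<noteq> 0"
  shows "lap_mult T 1 \<ge> 1"
proof (rule ccontr)
  assume "\<not> lap_mult T 1 \<ge> 1"
  then have "dim {x. laplacian T *v x = 1 *\<^sub>R x} = 0" unfolding lap_mult_def by linarith
  then have "{x. laplacian T *v x = 1 *\<^sub>R x} \<subseteq> {0}" by (simp only: dim_eq_0)
  moreover have "laplacian T *v (\<chi> i. x i) = 1 *\<^sub>R (\<chi> i. x i)" using assms eigenspace_1 by simp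
  ultimately have "(\<chi> i. x i) = (0 :: real^'v)" by blast
  then show False using assms(2) by (metis vec_lambda_beta zero_index)
qed

lemma lap_mult_G5:
  assumes "T \<cong>\<^sub>g G5"
  shows "lap_mult T 1 \<ge> 1"
proof -
  obtain f where f: "bij_betw f UNIV {..<11::nat}" "\<And>u v. adj T u v \<longleftrightarrow> adj G5 (f u) (f v)"
    using assms by (auto simp: graph_iso_def verts_UNIV verts_G5)
  \<comment> \<open>An eigenvector for 1: values 1, 2, 1 on the path \<open>a w b\<close>, and 0, -1
    outwards on each pendant path.\<close>
  define g :: "nat \<Rightarrow> real" where "g i = [1, 2, 1, 0, -1, 0, -1, 0, -1, 0, -1] ! i" for i
  \<comment> \<open>Summing differences over the neighbours applies the Laplacian without computing
    degrees.\<close>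
  have eig: "(\<Sum>j\<in>{..<11}. if adj G5 i j then g i - g j else 0) = g i" if "i < 11" for i
  proof -
    have "{..<11} = {0, 1, 2, 3, 4, 5, 6, 7, 8, 9, 10::nat}"
      by (simp add: lessThan_nat_numeral lessThan_Suc insert_commute)
    then have "i \<in> {0, 1, 2, 3, 4, 5, 6, 7, 8, 9, 10}" using that by blast
    then show ?thesis
      by (elim insertE emptyE)
        (simp_all add: lessThan_nat_numeral lessThan_Suc adj_def edges_G5 doubleton_eq_iff g_def)
  qed
  have "lapeq (g \<circ> f) v" for v
  proof -
    have "f v < 11" using f(1) by (auto simp: bij_betw_def)
    have "(\<Sum>w\<in>nbrs v. g (f v) - g (f w)) = (\<Sum>w\<in>UNIV. if adj T v w then g (f v) - g (f w) else 0)"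
      by (simp add: nbrs_def sum.If_cases)
    also have "\<dots> = (\<Sum>w\<in>UNIV. if adj G5 (f v) (f w) then g (f v) - g (f w) else 0)"
      by (simp add: f(2))
    also have "\<dots> = (\<Sum>j\<in>{..<11}. if adj G5 (f v) j then g (f v) - g j else 0)"
      by (rule sum.reindex_bij_betw[OF f(1)])
    also have "\<dots> = g (f v)" using \<open>f v < 11\<close> by (rule eig)
    finally show ?thesis by (simp add: lapeq_def sum_subtractf algebra_simps)
  qed
  moreover obtain v where "f v = 0"
  proof -
    have "0 \<in> f ` UNIV" using f(1) by (simp add: bij_betw_def)
    then show thesis using that by auto
  qed
  then have "(g \<circ> f) v \<noteq> 0" by (simp add: g_def)
  ultimately show ?thesis using lap_mult_pos by blast
qed

end

section \<open>Choice of the root and the global bound\<close>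

context reduced_tree
begin

text \<open>A smallest branch whose root is not a leaf has only leaves as children, and
  \<open>leaf_unique\<close> leaves just one. Such a branch exists, since otherwise the tree would
  have at most two vertices.\<close>

lemma exists_root:
  assumes "card (UNIV :: 'v set) \<ge> 3"
  obtains q p w where "nbrs q = {p, w}" "p \<noteq> w" "leaf p"
proof -
  have "\<exists>u v. u \<in> nbrs v \<and> \<not> leaf v"
  proof (rule ccontr)
    assume no: "\<nexists>u v. u \<in> nbrs v \<and> \<not> leaf v"
    obtain v :: 'v where True by blast
    show False
    proof (cases "nbrs v = {}")
      case True
      then show False using card_UNIV_rec[of v] assms by simp
    next
      case False
      then obtain w where w: "w \<in> nbrs v" by blast
      then have "leaf v" using no by blast
      then have Nv: "nbrs v = {w}" using leaf_nbrs w by blast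
      have "v \<in> nbrs w" using w nbrs_sym by blast
      then have "leaf w" "v \<in> nbrs w" using no by blast+
      then show False using card_UNIV_rec[of v] assms leaf_branch[of w v] Nv by simp
    qed
  qed
  then have ex: "\<exists>uv. fst uv \<in> nbrs (snd uv) \<and> \<not> leaf (snd uv)" by auto
  obtain uv where uv: "fst uv \<in> nbrs (snd uv) \<and> \<not> leaf (snd uv)"
    and min: "\<And>xy. fst xy \<in> nbrs (snd xy) \<and> \<not> leaf (snd xy) \<Longrightarrow>
      card (branch (fst uv) (snd uv)) \<le> card (branch (fst xy) (snd xy))"
    using ex_has_least_nat[of "\<lambda>xy. fst xy \<in> nbrs (snd xy) \<and> \<not> leaf (snd xy)" _
      "\<lambda>xy. card (branch (fst xy) (snd xy))"] ex by blast
  define u v where "u = fst uv" and "v = snd uv"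
  have u: "u \<in> nbrs v" and nl: "\<not> leaf v" using uv by (auto simp: u_def v_def)
  have leaves: "leaf w" if "w \<in> nbrs v - {u}" for w
  proof (rule ccontr)
    assume "\<not> leaf w"
    moreover have "v \<in> nbrs w" using that nbrs_sym by blast
    ultimately show False
      using min[of "(v, w)"] card_branch_less[OF u that] by (simp add: u_def v_def)
  qed
  have "nbrs v \<noteq> {u}" using nl by auto
  then obtain p where p: "p \<in> nbrs v - {u}" using u by blast
  have "nbrs v \<subseteq> {p, u}"
    using leaf_unique[of _ v p] leaves p by blast
  then have "nbrs v = {p, u}" using p u by blast
  then show thesis using that[of v p u] p leaves by blast
qed

text \<open>The leaf \<open>p\<close> forces \<open>x q = 0\<close>. A relation
  \<open>Some a\<close> then gives \<open>x w = 0\<close>, whereas \<open>None\<close> says nothing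
  about \<open>x w\<close>, which becomes a further parameter of cost 4. The 2 counts
  \<open>p\<close> and \<open>q\<close>.\<close>

lemma lap_mult_bound:
  assumes q: "nbrs q = {p, w}" "p \<noteq> w" "leaf p" and v: "branch_value q w r h"
  shows "4 * int (lap_mult T 1) \<le> int (card (UNIV :: 'v set)) - 2 - h + (if r = None then 4 else 0)"
proof -
  obtain S where S: "h \<le> int (card (branch q w)) - 4 * int (card S)"
    "\<And>x. (\<forall>y\<in>branch q w. lapeq x y) \<Longrightarrow>
       (case r of None \<Rightarrow> x q = 0 | Some a \<Rightarrow> x w = a * x q) \<and>
       (x q = 0 \<and> x w = 0 \<and> (\<forall>y\<in>S. x y = 0) \<longrightarrow> (\<forall>y\<in>branch q w. x y = 0))"
    using branch_value_determines[OF v] by blast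
  define S' where "S' = S \<union> (if r = None then {w} else {})"
  have "q \<in> nbrs p" using q nbrs_sym by blast
  then have Np: "nbrs p = {q}" using leaf_nbrs q by blast
  have "lap_mult T 1 \<le> card S'"
  proof (rule lap_mult_le)
    fix x assume x: "\<forall>v. lapeq x v" "\<forall>v\<in>S'. x v = 0"
    have xq: "x q = 0" using x(1) Np q(3) by (auto simp: lapeq_def dest: spec[of _ p])
    have xw: "x w = 0" using S(2)[of x] x xq by (cases r) (auto simp: S'_def)
    have "lapeq x q" using x by blast
    then have "x p = 0" using xq xw q(1,2) by (simp add: lapeq_def)
    moreover have "\<forall>y\<in>branch q w. x y = 0" using S(2)[of x] x xq xw by (auto simp: S'_def)
    moreover have "y = q \<or> y = p \<or> y \<in> branch q w" for y using root_split(1)[OF q] by blast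
    ultimately have "x y = 0" for y using xq by metis
    then show "x = (\<lambda>_. 0)" by blast
  qed
  moreover have "card S' \<le> card S + (if r = None then 1 else 0)"
    using card_Un_le[of S "{w}"] by (auto simp: S'_def)
  ultimately show ?thesis using S(1) root_split(2)[OF q] by (auto split: if_splits)
qed

lemma main_bound:
  assumes n: "card (UNIV :: 'v set) \<ge> 7" and notG1: "\<not> (\<exists>l\<ge>1. T \<cong>\<^sub>g G1 l)"
  shows "4 * int (lap_mult T 1) \<le> int (card (UNIV :: 'v set)) - 7 \<and>
    (4 * int (lap_mult T 1) = int (card (UNIV :: 'v set)) - 7 \<longrightarrow> T \<cong>\<^sub>g G4 \<or> T \<cong>\<^sub>g G5)"
proof -
  have "card (UNIV :: 'v set) \<ge> 3" using n by simp
  then obtain q p w where q: "nbrs q = {p, w}" "p \<noteq> w" "leaf p" using exists_root by blast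
  have qw: "q \<in> nbrs w" and qp: "q \<in> nbrs p" using q nbrs_sym by blast+
  have Np: "nbrs p = {q}" using leaf_nbrs q qp by blast
  obtain r h where v: "branch_value q w r h" using branch_value_exists[OF qw] by blast
  have nlq: "\<not> leaf q" using q by simp
  note cl = classified_branch_value[OF v nlq]
  have nlw: "\<not> leaf w" using leaf_unique[of p q w] q by auto
  \<comment> \<open>Degree two would make \<open>p\<close>, \<open>q\<close>, \<open>w\<close> a
    pendant path on three vertices.\<close>
  have deg: "card (nbrs w) \<ge> 3"
  proof (rule ccontr)
    assume "\<not> card (nbrs w) \<ge> 3"
    moreover have "card (nbrs w) \<noteq> 0" using qw by auto
    ultimately have "card (nbrs w) = 2" using nlw by linarith
    then obtain c where "nbrs w = {q, c}" "c \<noteq> q" using qw by (auto simp: card_2_iff doubleton_eq_iff)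
    then show False using no_pendant_P3[OF Np q(1)] q(2) by blast
  qed
  \<comment> \<open>The target asks for excess at least 5, or at least 9 for relation
    \<open>None\<close>.\<close>
  note bound = lap_mult_bound[OF q v]
  from cl nlw show ?thesis
  proof (rule child_cases)
    assume "tip q w"
    then have "card (nbrs w) \<le> 2" by (auto simp: tip_def card_insert_if)
    then show ?thesis using deg by simp
  next
    assume *: "r = Some 0" "h \<ge> 4" "h \<noteq> 5" "h = 4 \<longrightarrow> chain q w"
    have "h \<noteq> 4" using chain_iso_G1[OF q] * notG1 by blast
    then show ?thesis using * bound by auto
  next
    assume i: "plain q w r h"
    show ?thesis
    proof (cases r)
      case None
      then have h: "h \<ge> 9" "h = 9 \<Longrightarrow> \<exists>a b. nbrs w = {q, a, b} \<and> distinct [q, a, b] \<and> tip w a \<and> stem w b"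
        using i deg unfolding plain_def by blast+
      then have "h = 9 \<Longrightarrow> T \<cong>\<^sub>g G5" using stem_iso_G5[OF q] by blast
      then show ?thesis using h(1) bound None by auto
    next
      case (Some a)
      have "h \<ge> 5" using i by (simp add: plain_def)
      moreover have "T \<cong>\<^sub>g G4" if "h = 5"
      proof -
        \<comment> \<open>The other extremal branch of excess 5 has a root of degree two.\<close>
        have "\<not> (\<exists>c. nbrs w = {q, c} \<and> c \<noteq> q \<and> chain w c)" using deg by auto
        then have "fork q w" using i that unfolding plain_def by blast
        then show ?thesis using fork_iso_G4[OF q] by blast
      qed
      ultimately show ?thesis using bound Some by auto
    qed
  qed
qed

end

section \<open>Translation of the hypotheses and the final theorem\<close>

lemma reduced_treeI:
  fixes T :: "'v::finite ugraph"
  assumes V: "verts T = UNIV" and tree: "is_tree T" and red: "reduced_graph T"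
    and P3: "\<not> has_pendant_path 3 T"
  shows "reduced_tree T"
proof -
  interpret tree T by unfold_locales (fact V tree)+
  have deg: "vdegree T v = card (nbrs v)" for v by (simp add: vdegree_def nbrs_def V)
  define f where "f p = the_elem (nbrs p)" for p
  have pend: "pendant T = {p. card (nbrs p) = 1}" by (simp add: pendant_def V deg)
  have f_eq: "f p = v" if "v \<in> nbrs p" "card (nbrs p) = 1" for p v
    using that by (auto simp: f_def card_1_singleton_iff)
  \<comment> \<open>Sending a leaf to its neighbour is onto the quasi-pendant vertices; equal
    cardinalities make it injective, which is \<open>leaf_unique\<close>.\<close>
  have "f ` pendant T = quasi_pendant T"
  proof (intro equalityI subsetI)
    fix v assume "v \<in> f ` pendant T"
    then obtain p where p: "card (nbrs p) = 1" "v = f p" by (auto simp: pend)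
    from p(1) obtain x where "nbrs p = {x}" by (rule card_1_singletonE)
    then have "v \<in> nbrs p" using p(2) by (simp add: f_def)
    then have "p \<in> nbrs v" using nbrs_sym by blast
    then show "v \<in> quasi_pendant T" using p(1) by (auto simp: quasi_pendant_def pend V nbrs_def)
  next
    fix v assume "v \<in> quasi_pendant T"
    then obtain p where p: "card (nbrs p) = 1" "p \<in> nbrs v" by (auto simp: quasi_pendant_def pend nbrs_def)
    then have "f p = v" using nbrs_sym f_eq by blast
    then show "v \<in> f ` pendant T" using p by (auto simp: pend)
  qed
  then have inj: "inj_on f (pendant T)"
    using red unfolding reduced_graph_def by (intro eq_card_imp_inj_on) auto
  show ?thesis
  proof
    fix p p' v assume *: "p \<in> nbrs v" "p' \<in> nbrs v" "card (nbrs p) = 1" "card (nbrs p') = 1"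
    then have "f p = v" "f p' = v" using nbrs_sym f_eq by blast+
    then show "p = p'" using inj * by (auto simp: pend inj_on_def)
  next
    fix p q c v assume Np: "nbrs p = {q}" and Nq: "nbrs q = {p, c}" and Nc: "nbrs c = {q, v}"
    show "p = c \<or> v = q"
    proof (rule ccontr)
      assume "\<not> (p = c \<or> v = q)"
      then have pc: "p \<noteq> c" and vq: "v \<noteq> q" by auto
      have cv: "c \<in> nbrs v" and cq: "c \<in> nbrs q" and qp: "q \<in> nbrs p" using Nc Nq Np nbrs_sym by blast+
      have D: "nbrs q - {c} = {p}" "nbrs p - {q} = {}" using Nq Np pc by auto
      have branch: "branch c q = {q, p}" "branch_edges c q = {{q, p}}"
        using branch_rec[OF cq] branch_edges_rec[OF cq] branch_rec[OF qp] branch_edges_rec[OF qp] unfolding D by simp_all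
      have U: "UNIV = {c, q, p} \<union> branch c v"
        using UNIV_rec[of c] unfolding Nc by (simp add: branch insert_commute)
      have E: "edges T = {{c, q}, {q, p}, {v, c}} \<union> branch_edges c v"
        using edges_rec[of c] unfolding Nc by (simp add: branch insert_commute)
      have disj: "{c, q, p} \<inter> branch c v = {}"
        using branch_disjoint[of q c v] parent_notin_branch[of v c] Nc vq branch by auto
      \<comment> \<open>The part of the tree beyond \<open>c\<close>, to which the path
        \<open>[c, q, p]\<close> is attached at \<open>v\<close>. It is connected because all its
        vertices are reachable from \<open>v\<close>.\<close>
      define H where "H = \<lparr>verts = branch c v, edges = branch_edges c v\<rparr>"
      have adjH: "adj H a b \<longleftrightarrow> adj T a b \<and> a \<in> branch c v \<and> b \<in> branch c v" for a b
        by (auto simp: H_def adj_def branch_edges_def)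
      have "symp (adj H)" by (auto simp: symp_def adj_def insert_commute)
      then have sym: "symp (adj H)\<^sup>*\<^sup>*" by (rule symp_rtranclp)
      have reach: "(adj H)\<^sup>*\<^sup>* v x" if "x \<in> branch c v" for x
        using that
      proof (induction rule: branch_induct)
        case (step y z)
        then have "z \<in> branch c v" using branch_step by blast
        then have "adj H y z" using step by (simp add: adjH nbrs_def)
        then show ?case using step by auto
      qed simp
      have "connected_graph H"
        unfolding connected_graph_def
      proof (intro conjI ballI)
        have "branch c v \<noteq> {}" using branch_self[of v c] by blast
        then show "simple_graph H" using edge_card by (auto simp: simple_graph_def H_def branch_edges_def)
        fix x y assume "x \<in> verts H" "y \<in> verts H"
        then have "(adj H)\<^sup>*\<^sup>* v x" "(adj H)\<^sup>*\<^sup>* v y" using reach by (auto simp: H_def)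
        then show "(adj H)\<^sup>*\<^sup>* x y" using sym by (meson rtranclp_trans sympD)
      qed
      moreover have "T = attach_path H v [c, q, p]"
        using U E V by (cases T) (auto simp: attach_path_def H_def)
      moreover have "distinct [c, q, p]" using pc cq qp nbrs_irrefl by auto
      moreover have "v \<in> verts H" "set [c, q, p] \<inter> verts H = {}" "length [c, q, p] = 3"
        using disj by (auto simp: H_def)
      ultimately have "has_pendant_path 3 T" unfolding has_pendant_path_def by blast
      then show False using P3 by blast
    qed
  qed
qed

theorem theorem1p4:
  fixes T :: "'v::finite ugraph" and n :: nat
  assumes "verts T = UNIV"
    and "n = card (verts T)"
    and "is_tree T"
    and "reduced_graph T"
    and "n \<ge> 7"
    and "\<not> has_pendant_path 3 T"
    and "\<not> (\<exists>l\<ge>1. T \<cong>\<^sub>g G1 l)"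
  shows "real (lap_mult T 1) \<le> (real n - 7) / 4 \<and>
         (real (lap_mult T 1) = (real n - 7) / 4 \<longleftrightarrow> T \<cong>\<^sub>g G4 \<or> T \<cong>\<^sub>g G5)"
proof -
  interpret reduced_tree T using assms reduced_treeI by blast
  have n: "n = card (UNIV :: 'v set)" using assms by simp
  have main: "4 * int (lap_mult T 1) \<le> int n - 7"
    "4 * int (lap_mult T 1) = int n - 7 \<Longrightarrow> T \<cong>\<^sub>g G4 \<or> T \<cong>\<^sub>g G5"
    using main_bound assms(5,7) unfolding n by blast+
  \<comment> \<open>For \<open>n = 7\<close> the upper bound is 0, so equality is automatic.\<close>
  have "4 * int (lap_mult T 1) = int n - 7" if "T \<cong>\<^sub>g G4"
  proof -
    have "n = 7" using that assms(2) by (auto simp: graph_iso_def verts_G4 dest: bij_betw_same_card)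
    then show ?thesis using main(1) by simp
  qed
  \<comment> \<open>For \<open>n = 11\<close> the upper bound is 1, and the explicit eigenvector
    attains it.\<close>
  moreover have "4 * int (lap_mult T 1) = int n - 7" if "T \<cong>\<^sub>g G5"
  proof -
    have "n = 11" using that assms(2) by (auto simp: graph_iso_def verts_G5 dest: bij_betw_same_card)
    then show ?thesis using main(1) lap_mult_G5[OF that] by simp
  qed
  ultimately have "4 * int (lap_mult T 1) = int n - 7 \<longleftrightarrow> T \<cong>\<^sub>g G4 \<or> T \<cong>\<^sub>g G5"
    using main(2) by blast
  moreover have "real (lap_mult T 1) = (real n - 7) / 4 \<longleftrightarrow> 4 * int (lap_mult T 1) = int n - 7"
  proof -
    have "real (lap_mult T 1) = (real n - 7) / 4 \<longleftrightarrow> real (4 * lap_mult T 1 + 7) = real n"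
      by (simp add: field_simps)
    also have "\<dots> \<longleftrightarrow> 4 * int (lap_mult T 1) = int n - 7" unfolding of_nat_eq_iff by linarith
    finally show ?thesis .
  qed
  moreover have "real (lap_mult T 1) \<le> (real n - 7) / 4"
  proof -
    have "4 * lap_mult T 1 + 7 \<le> n" using main(1) by linarith
    then have "real (4 * lap_mult T 1 + 7) \<le> real n" by (simp only: of_nat_le_iff)
    then show ?thesis by (simp add: field_simps)
  qed
  ultimately show ?thesis by simp
qed

end
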